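(* Let $K$ be a field and let $E$ be a countable row-finite graph. Then there is an injective $*$-preserving $K$-algebra homomorphism $$\psi: L_K(E)\hookrightarrow L_K(1,2)\otimes_K L_K(1,2)$$ which preserves the $\mathbb{Z}$-gradings, where $L_K(E)$ carries its canonical $\mathbb{Z}$-grading and $L_K(1,2)\otimes_K L_K(1,2)$ carries the $\mathbb{Z}$-grading induced by the canonical grading on the first tensor factor and the trivial grading on the second tensor factor.
   Context: A (directed) graph $E=(E^0,E^1,s,r)$ consists of disjoint sets $E^0$ (vertices) and $E^1$ (edges) and maps $s,r:E^1\to E^0$. It is countable if $E^0$ and $E^1$ are countable, and row-finite if $|s^{-1}(v)|<\infty$ for all $v\in E^0$. A vertex $v$ is regular if $0<|s^{-1}(v)|<\infty$. The Leavitt path algebra $L_K(E)$ is the (not necessarily unital) $K$-algebra generated by $E^0\cup E^1\cup\{e^*:e\in E^1\}$ with relations, for all $v,w\in E^0$, $e,f\in E^1$: (1) $vw=\delta_{v,w}w$; (2) $s(e)e=e=er(e)$ and $r(e)e^*=e^*=e^*s(e)$; (3) $e^*f=\delta_{e,f}r(e)$; (4) $v=\sum_{e\in s^{-1}(v)}ee^*$ for every regular vertex $v$. Its canonical $\mathbb{Z}$-grading has $\deg v=0$, $\deg e=1$, $\deg e^*=-1$. Its involution $*$ is the $K$-linear anti-automorphism with $v\mapsto v$, $e\mapsto e^*$, $e^*\mapsto e$. $L_K(1,2)$ is the unital $K$-algebra generated by $x_1,x_2,x_1^*,x_2^*$ with relations $x_1x_1^*+x_2x_2^*=1$, $x_1^*x_1=x_2^*x_2=1$,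 $x_1^*x_2=x_2^*x_1=0$; its canonical grading has $\deg x_i=1$, $\deg x_i^*=-1$, and its $K$-linear involution exchanges $x_i$ and $x_i^*$. On the tensor product, $(a\otimes b)^*=a^*\otimes b^*$, and $\deg(a\otimes b)=\deg a$ for $a$ homogeneous in $L_K(1,2)$ and any $b$. *)

theory Defs
  imports
    "HOL-Algebra.QuotRing"
    "HOL-Algebra.Module"
    "HOL-Library.Poly_Mapping"
    "HOL-Library.Countable_Set"
    "Graph_Theory.Digraph"
begin

section \<open>Graded algebras with involution\<close>

text \<open>
  The scalars are all elements of a type \<open>'k\<close> of class \<^class>\<open>field\<close>. Algebras need not be
  unital: the field \<^const>\<open>one\<close>, inherited from \<open>HOL-Algebra\<close>, is never referred to for a
  non-unital algebra. \<open>component A n\<close> is the homogeneous component of degree \<open>n\<close>.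
\<close>

record ('k, 'a) graded_star_algebra = "('k, 'a) module" +
  star :: "'a \<Rightarrow> 'a"
  component :: "int \<Rightarrow> 'a set"

definition algebra_hom ::
  "('k::field, 'a, 'm) module_scheme \<Rightarrow> ('k, 'b, 'n) module_scheme \<Rightarrow> ('a \<Rightarrow> 'b) set" where
  "algebra_hom A B =
     {h \<in> hom A B \<inter> hom (add_monoid A) (add_monoid B).
        \<forall>c. \<forall>x\<in>carrier A. h (c \<odot>\<^bsub>A\<^esub> x) = c \<odot>\<^bsub>B\<^esub> h x}"

definition linear_subspace :: "('k::field, 'a, 'm) module_scheme \<Rightarrow> 'a set \<Rightarrow> bool" where
  "linear_subspace A U \<longleftrightarrow>
     additive_subgroup U A \<and> (\<forall>c. \<forall>x\<in>U. c \<odot>\<^bsub>A\<^esub> x \<in> U)"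

definition linear_span :: "('k::field, 'a, 'm) module_scheme \<Rightarrow> 'a set \<Rightarrow> 'a set" where
  "linear_span A S = \<Inter>{U. linear_subspace A U \<and> S \<subseteq> U}"

definition algebra_ideal :: "('k::field, 'a, 'm) module_scheme \<Rightarrow> 'a set \<Rightarrow> bool" where
  "algebra_ideal A I \<longleftrightarrow>
     linear_subspace A I \<and>
     (\<forall>a\<in>carrier A. \<forall>x\<in>I. a \<otimes>\<^bsub>A\<^esub> x \<in> I \<and> x \<otimes>\<^bsub>A\<^esub> a \<in> I)"

definition ideal_generated :: "('k::field, 'a, 'm) module_scheme \<Rightarrow> 'a set \<Rightarrow> 'a set" where
  "ideal_generated A S = \<Inter>{I. algebra_ideal A I \<and> S \<subseteq> I}"

text \<open>
  The quotient extends the quotient ring \<open>A Quot I\<close> by the induced scalar multiplication,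
  involution and grading. It is used only for star-closed ideals generated by homogeneous
  elements, so that all of these are well defined on cosets.
\<close>

definition quotient_algebra ::
  "('k::field, 'a) graded_star_algebra \<Rightarrow> 'a set \<Rightarrow> ('k, 'a set) graded_star_algebra" where
  "quotient_algebra A I =
     \<lparr>carrier = carrier (A Quot I), mult = mult (A Quot I), one = one (A Quot I),
      zero = zero (A Quot I), add = add (A Quot I),
      smult = (\<lambda>c X. \<Union>x\<in>X. I +>\<^bsub>A\<^esub> (c \<odot>\<^bsub>A\<^esub> x)),
      star = (\<lambda>X. \<Union>x\<in>X. I +>\<^bsub>A\<^esub> star A x),
      component = (\<lambda>n. (\<lambda>x. I +>\<^bsub>A\<^esub> x) ` component A n)\<rparr>"

definition trivially_graded ::
  "('k::field, 'a) graded_star_algebra \<Rightarrow> ('k, 'a) graded_star_algebra" where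
  "trivially_graded A = A\<lparr>component := (\<lambda>n. if n = 0 then carrier A else {\<zero>\<^bsub>A\<^esub>})\<rparr>"


section \<open>Free algebras\<close>

text \<open>
  Lists form the free monoid under concatenation, so that \<open>'g list \<Rightarrow>\<^sub>0 'k\<close> with the
  convolution product of \<open>Poly_Mapping\<close> is the free unital algebra on \<open>'g\<close>.
\<close>

instantiation list :: (type) monoid_add
begin

definition zero_list :: "'a list" where "zero_list = []"

definition plus_list :: "'a list \<Rightarrow> 'a list \<Rightarrow> 'a list" where "plus_list = append"

instance by standard (simp_all add: zero_list_def plus_list_def)

end

definition scale :: "'k::field \<Rightarrow> ('x \<Rightarrow>\<^sub>0 'k) \<Rightarrow> ('x \<Rightarrow>\<^sub>0 'k)" where
  "scale c p = Poly_Mapping.map ((*) c) p"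

definition linear_extension :: "('x \<Rightarrow> ('y \<Rightarrow>\<^sub>0 'k)) \<Rightarrow> ('x \<Rightarrow>\<^sub>0 'k::field) \<Rightarrow> ('y \<Rightarrow>\<^sub>0 'k)" where
  "linear_extension f p = (\<Sum>x\<in>Poly_Mapping.keys p. scale (Poly_Mapping.lookup p x) (f x))"

text \<open>
  The algebra with basis a subsemigroup \<open>W\<close> of words: \<open>W = lists G\<close> gives the free unital algebra
  on \<open>G\<close>, and \<open>W = lists G - {[]}\<close> the free non-unital one (whose carrier does not contain the
  field \<^const>\<open>one\<close>). The maps \<open>st\<close> and \<open>deg\<close> give the involution and the degree on generators.
\<close>

definition word_algebra ::
  "'g list set \<Rightarrow> ('g \<Rightarrow> 'g) \<Rightarrow> ('g \<Rightarrow> int) \<Rightarrow> ('k::field, 'g list \<Rightarrow>\<^sub>0 'k) graded_star_algebra" where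
  "word_algebra W st deg =
     \<lparr>carrier = {p. Poly_Mapping.keys p \<subseteq> W}, mult = (*), one = 1, zero = 0, add = (+),
      smult = scale,
      star = linear_extension (\<lambda>w. Poly_Mapping.single (rev (map st w)) 1),
      component = (\<lambda>n. {p. \<forall>w\<in>Poly_Mapping.keys p. w \<in> W \<and> sum_list (map deg w) = n})\<rparr>"

definition gen :: "'g \<Rightarrow> ('g list \<Rightarrow>\<^sub>0 'k::field)" where
  "gen g = Poly_Mapping.single [g] 1"


section \<open>Leavitt path algebras\<close>

text \<open>
  In a \<^typ>\<open>('v, 'e) pre_digraph\<close> the source and range maps are \<^const>\<open>tail\<close> and \<^const>\<open>head\<close>.
\<close>

definition row_finite :: "('v, 'e) pre_digraph \<Rightarrow> bool" where
  "row_finite E \<longleftrightarrow> (\<forall>v\<in>verts E. finite (out_arcs E v))"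

definition regular_vertex :: "('v, 'e) pre_digraph \<Rightarrow> 'v \<Rightarrow> bool" where
  "regular_vertex E v \<longleftrightarrow> v \<in> verts E \<and> finite (out_arcs E v) \<and> out_arcs E v \<noteq> {}"

datatype ('v, 'e) lpa_gen = Vertex 'v | Edge 'e | Ghost 'e

fun lpa_gen_star :: "('v, 'e) lpa_gen \<Rightarrow> ('v, 'e) lpa_gen" where
  "lpa_gen_star (Vertex v) = Vertex v"
| "lpa_gen_star (Edge e) = Ghost e"
| "lpa_gen_star (Ghost e) = Edge e"

fun lpa_gen_deg :: "('v, 'e) lpa_gen \<Rightarrow> int" where
  "lpa_gen_deg (Vertex v) = 0"
| "lpa_gen_deg (Edge e) = 1"
| "lpa_gen_deg (Ghost e) = - 1"

definition lpa_gens :: "('v, 'e) pre_digraph \<Rightarrow> ('v, 'e) lpa_gen set" where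
  "lpa_gens E = Vertex ` verts E \<union> Edge ` arcs E \<union> Ghost ` arcs E"

text \<open>For each defining relation, the difference of its two sides.\<close>

definition lpa_relators ::
  "('v, 'e) pre_digraph \<Rightarrow> (('v, 'e) lpa_gen list \<Rightarrow>\<^sub>0 'k::field) set" where
  "lpa_relators E =
     {gen (Vertex v) * gen (Vertex w) - (if v = w then gen (Vertex w) else 0) | v w.
        v \<in> verts E \<and> w \<in> verts E}
   \<union> {gen (Vertex (tail E e)) * gen (Edge e) - gen (Edge e) | e. e \<in> arcs E}
   \<union> {gen (Edge e) * gen (Vertex (head E e)) - gen (Edge e) | e. e \<in> arcs E}
   \<union> {gen (Vertex (head E e)) * gen (Ghost e) - gen (Ghost e) | e. e \<in> arcs E}
   \<union> {gen (Ghost e) * gen (Vertex (tail E e)) - gen (Ghost e) | e. e \<in> arcs E}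
   \<union> {gen (Ghost e) * gen (Edge f) - (if e = f then gen (Vertex (head E e)) else 0) | e f.
        e \<in> arcs E \<and> f \<in> arcs E}
   \<union> {gen (Vertex v) - (\<Sum>e\<in>out_arcs E v. gen (Edge e) * gen (Ghost e)) | v.
        regular_vertex E v}"

definition leavitt_path_algebra ::
  "'k::field itself \<Rightarrow> ('v, 'e) pre_digraph
     \<Rightarrow> ('k, (('v, 'e) lpa_gen list \<Rightarrow>\<^sub>0 'k) set) graded_star_algebra" where
  "leavitt_path_algebra K E =
     (let F = word_algebra (lists (lpa_gens E) - {[]}) lpa_gen_star lpa_gen_deg
      in quotient_algebra F (ideal_generated F (lpa_relators E)))"


section \<open>The Leavitt algebra of type (1,2)\<close>

text \<open>\<open>X1s\<close> and \<open>X2s\<close> are the adjoints of \<open>X1\<close> and \<open>X2\<close>.\<close>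

datatype l12_gen = X1 | X2 | X1s | X2s

fun l12_gen_star :: "l12_gen \<Rightarrow> l12_gen" where
  "l12_gen_star X1 = X1s"
| "l12_gen_star X2 = X2s"
| "l12_gen_star X1s = X1"
| "l12_gen_star X2s = X2"

fun l12_gen_deg :: "l12_gen \<Rightarrow> int" where
  "l12_gen_deg X1 = 1"
| "l12_gen_deg X2 = 1"
| "l12_gen_deg X1s = - 1"
| "l12_gen_deg X2s = - 1"

definition l12_relators :: "(l12_gen list \<Rightarrow>\<^sub>0 'k::field) set" where
  "l12_relators =
     {gen X1 * gen X1s + gen X2 * gen X2s - 1,
      gen X1s * gen X1 - 1, gen X2s * gen X2 - 1,
      gen X1s * gen X2, gen X2s * gen X1}"

definition leavitt_algebra_1_2 ::
  "'k::field itself \<Rightarrow> ('k, (l12_gen list \<Rightarrow>\<^sub>0 'k) set) graded_star_algebra" where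
  "leavitt_algebra_1_2 K =
     (let F = word_algebra UNIV l12_gen_star l12_gen_deg
      in quotient_algebra F (ideal_generated F l12_relators))"


section \<open>Tensor products\<close>

text \<open>
  \<open>pair_algebra A B\<close> is the vector space with basis \<open>carrier A \<times> carrier B\<close>, with the operations
  which the tensor product inherits: \<open>(a,b)(a',b') = (aa',bb')\<close>, \<open>(a,b)\<^sup>* = (a\<^sup>*,b\<^sup>*)\<close>, and
  \<open>(a,b)\<close> of degree \<open>i + j\<close> for \<open>a\<close> of degree \<open>i\<close> and \<open>b\<close> of degree \<open>j\<close>.
\<close>

definition pair_algebra ::
  "('k::field, 'a) graded_star_algebra \<Rightarrow> ('k, 'b) graded_star_algebra
     \<Rightarrow> ('k, 'a \<times> 'b \<Rightarrow>\<^sub>0 'k) graded_star_algebra" where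
  "pair_algebra A B =
     \<lparr>carrier = {p. Poly_Mapping.keys p \<subseteq> carrier A \<times> carrier B},
      mult = (\<lambda>p q. linear_extension (\<lambda>(a, b). linear_extension
         (\<lambda>(a', b'). Poly_Mapping.single (a \<otimes>\<^bsub>A\<^esub> a', b \<otimes>\<^bsub>B\<^esub> b') 1) q) p),
      one = Poly_Mapping.single (\<one>\<^bsub>A\<^esub>, \<one>\<^bsub>B\<^esub>) 1, zero = 0, add = (+),
      smult = scale,
      star = linear_extension (\<lambda>(a, b). Poly_Mapping.single (star A a, star B b) 1),
      component = (\<lambda>n. {p. \<forall>(a, b)\<in>Poly_Mapping.keys p.
         \<exists>i j. i + j = n \<and> a \<in> component A i \<and> b \<in> component B j})\<rparr>"

abbreviation pair :: "'a \<Rightarrow> 'b \<Rightarrow> ('a \<times> 'b \<Rightarrow>\<^sub>0 'k::field)" where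
  "pair a b \<equiv> Poly_Mapping.single (a, b) 1"

definition bilinearity_relators ::
  "('k::field, 'a) graded_star_algebra \<Rightarrow> ('k, 'b) graded_star_algebra
     \<Rightarrow> ('a \<times> 'b \<Rightarrow>\<^sub>0 'k) set" where
  "bilinearity_relators A B =
     {pair (a \<oplus>\<^bsub>A\<^esub> a') b - pair a b - pair a' b | a a' b.
        a \<in> carrier A \<and> a' \<in> carrier A \<and> b \<in> carrier B}
   \<union> {pair a (b \<oplus>\<^bsub>B\<^esub> b') - pair a b - pair a b' | a b b'.
        a \<in> carrier A \<and> b \<in> carrier B \<and> b' \<in> carrier B}
   \<union> {pair (c \<odot>\<^bsub>A\<^esub> a) b - scale c (pair a b) | c a b. a \<in> carrier A \<and> b \<in> carrier B}
   \<union> {pair a (c \<odot>\<^bsub>B\<^esub> b) - scale c (pair a b) | c a b. a \<in> carrier A \<and> b \<in> carrier B}"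

text \<open>
  The span of the relators is already a star-closed two-sided ideal of \<open>pair_algebra A B\<close>, as
  the multiplications of \<open>A\<close> and \<open>B\<close> are bilinear and their involutions are linear.
\<close>

definition tensor_product ::
  "('k::field, 'a) graded_star_algebra \<Rightarrow> ('k, 'b) graded_star_algebra
     \<Rightarrow> ('k, ('a \<times> 'b \<Rightarrow>\<^sub>0 'k) set) graded_star_algebra" where
  "tensor_product A B =
     quotient_algebra (pair_algebra A B)
       (linear_span (pair_algebra A B) (bilinearity_relators A B))"

end

theory Submission
  imports Defs "HOL-Library.Product_Plus"
begin

text \<open>
  Let \<open>L\<close> be the Leavitt algebra of type (1,2) with generators \<open>x\<^sub>1, x\<^sub>2\<close>. There is no unitary of degree 1
  in \<open>L\<close>, but there is one in \<open>L \<otimes> L\<close> when only the first factor is graded, namely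
  \<open>U = x\<^sub>1 \<otimes> x\<^sub>1\<^sup>* + x\<^sub>2 \<otimes> x\<^sub>2\<^sup>*\<close>. The second factor is large enough for everything else. It contains
  isometries \<open>y\<^sub>v\<close>, one for each of the countably many vertices, with orthogonal ranges (the words
  \<open>x\<^sub>2\<^sup>n x\<^sub>1\<close>). For each regular vertex \<open>v\<close> it also contains isometries \<open>t\<^sub>e\<close>, one for each of the
  finitely many edges \<open>e\<close> that start in \<open>v\<close>, whose ranges are orthogonal and have sum 1 (the words of
  a complete prefix code). The embedding is
  \<open>v \<mapsto> 1 \<otimes> y\<^sub>v y\<^sub>v\<^sup>*\<close> and \<open>e \<mapsto> (1 \<otimes> y\<^sub>s) U (1 \<otimes> t\<^sub>e y\<^sub>r\<^sup>*)\<close> with \<open>s, r\<close> the source and the range of \<open>e\<close>,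
  and with the adjoint of the latter as the image of \<open>e\<^sup>*\<close>. That the defining relations hold
  (\<open>family_map_relator\<close>) uses only that the \<open>y\<^sub>v\<close> and \<open>t\<^sub>e\<close> are orthogonal isometries, that
  the \<open>t\<^sub>e t\<^sub>e\<^sup>*\<close> sum to 1, and that \<open>U\<close> is unitary. The edges go to elements of degree 1 because \<open>U\<close> does.

  Injectivity is an instance of graded uniqueness (\<open>graded_uniqueness\<close>). Modulo the relations,
  every element of a Leavitt path algebra of a row-finite graph is a linear combination of
  monomials \<open>\<alpha> \<beta>\<^sup>*\<close> in which \<open>\<beta>\<close> either has one fixed length or is shorter and ends in a sink. No two such
  \<open>\<beta>\<close> extend each other, so multiplication by \<open>\<alpha>\<^sub>0\<^sup>*\<close> and \<open>\<beta>\<^sub>0\<close> turns the combination into the multiple of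
  a vertex by the coefficient of \<open>\<alpha>\<^sub>0 \<beta>\<^sub>0\<^sup>*\<close>, plus terms of nonzero degree. A linear form on the target
  that ignores nonzero degrees and does not vanish on the image of the vertex shows that the
  coefficient is zero if the given element lies in the kernel. Such a form is a product of two matrix coefficients of the
  representation of \<open>L\<close> on the basis \<open>\<int> \<times> \<nat>\<close> that splits \<open>\<nat>\<close> into even and odd numbers and
  records the degree in \<open>\<int>\<close> (\<open>square_form_square_ideal\<close>).

  All algebras involved are quotients. The computations take place in the algebras above them, that is, in
  spaces of finitely supported functions, where pairs of words model \<open>L \<otimes> L\<close> before its
  relations are imposed, and \<open>quotient_embedding\<close> passes to the quotients.
\<close>

section \<open>Linear maps between spaces of finitely supported functions\<close>

lemma lookup_scale [simp]: "Poly_Mapping.lookup (scale c p) x = c * Poly_Mapping.lookup p x"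
  unfolding scale_def by (simp add: Poly_Mapping.map.rep_eq when_def)

lemma scale_single [simp]: "scale c (Poly_Mapping.single x d) = Poly_Mapping.single x (c * d)"
  by (intro poly_mapping_eqI) (simp add: lookup_single when_def)

lemma scale_zero_right [simp]: "scale c 0 = 0"
  and scale_zero_left [simp]: "scale 0 p = 0"
  and scale_one [simp]: "scale 1 p = p"
  and scale_scale [simp]: "scale c (scale d p) = scale (c * d) p"
  and scale_add: "scale c (p + q) = scale c p + scale c q"
  and scale_add_left: "scale (c + d) p = scale c p + scale d p"
  and scale_minus_one: "scale (- 1) p = - p"
  and scale_diff: "scale c (p - q) = scale c p - scale c q"
  by (intro poly_mapping_eqI; simp add: lookup_add lookup_minus algebra_simps)+

lemma scale_sum: "scale c (sum f A) = (\<Sum>x\<in>A. scale c (f x))"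
  by (induction A rule: infinite_finite_induct) (simp_all add: scale_add)

lemma scale_mult_left: "scale c p * q = scale c (p * q)"
  for p q :: "'a::monoid_add \<Rightarrow>\<^sub>0 'k::field"
  by (simp add: scale_def mult_map_scale_conv_mult mult.assoc)

lemma poly_mapping_eq_sum_single:
  "p = (\<Sum>x\<in>Poly_Mapping.keys p. Poly_Mapping.single x (Poly_Mapping.lookup p x))"
proof (intro poly_mapping_eqI)
  fix x
  have "Poly_Mapping.lookup (\<Sum>y\<in>Poly_Mapping.keys p. Poly_Mapping.single y (Poly_Mapping.lookup p y)) x
    = (\<Sum>y\<in>Poly_Mapping.keys p. if y = x then Poly_Mapping.lookup p y else 0)"
    by (simp add: lookup_sum lookup_single when_def)
  then show "Poly_Mapping.lookup p x =
      Poly_Mapping.lookup (\<Sum>y\<in>Poly_Mapping.keys p. Poly_Mapping.single y (Poly_Mapping.lookup p y)) x"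
    by (auto simp: in_keys_iff)
qed

text \<open>
  A property which defines a subspace holds for everything supported on \<open>X\<close> once it holds for
  the basis vectors from \<open>X\<close>.
\<close>

lemma span_induct_on [consumes 1, case_names zero add scale single]:
  assumes "Poly_Mapping.keys p \<subseteq> X"
    and zero: "P 0"
    and add: "\<And>p q. P p \<Longrightarrow> P q \<Longrightarrow> P (p + q)"
    and scale: "\<And>c p. P p \<Longrightarrow> P (scale c p)"
    and single: "\<And>x. x \<in> X \<Longrightarrow> P (Poly_Mapping.single x (1::'k::field))"
  shows "P p"
proof -
  have sum: "P (sum f A)" if "\<And>x. x \<in> A \<Longrightarrow> P (f x)" for f :: "'a \<Rightarrow> ('a \<Rightarrow>\<^sub>0 'k)" and A
    using that by (induction A rule: infinite_finite_induct) (auto intro: zero add)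
  have "P (\<Sum>x\<in>Poly_Mapping.keys p. scale (Poly_Mapping.lookup p x) (Poly_Mapping.single x 1))"
    using assms(1) by (intro sum scale single) auto
  then show ?thesis
    using poly_mapping_eq_sum_single[of p] by simp
qed

lemma scale_mult_right: "p * scale c q = scale c (p * q)"
  for p q :: "'a::monoid_add \<Rightarrow>\<^sub>0 'k::field"
  using subset_UNIV
proof (induction p rule: span_induct_on)
  case (single u)
  show ?case
    using subset_UNIV
    by (induction q arbitrary: c rule: span_induct_on)
       (simp_all add: scale_add distrib_left mult_single)
qed (simp_all add: scale_add distrib_right scale_mult_left mult.commute)

text \<open>Functionals are handled separately from \<^const>\<open>linear_extension\<close>, whose values are
  again finitely supported functions.\<close>

definition linear_form :: "('x \<Rightarrow> 'k::field) \<Rightarrow> ('x \<Rightarrow>\<^sub>0 'k) \<Rightarrow> 'k" where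
  "linear_form f p = (\<Sum>x\<in>Poly_Mapping.keys p. Poly_Mapping.lookup p x * f x)"

lemma linear_form_superset:
  assumes "finite A" "Poly_Mapping.keys p \<subseteq> A"
  shows "linear_form f p = (\<Sum>x\<in>A. Poly_Mapping.lookup p x * f x)"
  unfolding linear_form_def using assms
  by (intro sum.mono_neutral_left) (auto simp: in_keys_iff)

lemma linear_form_zero [simp]: "linear_form f 0 = 0"
  by (simp add: linear_form_def)

lemma linear_form_single [simp]: "linear_form f (Poly_Mapping.single x c) = c * f x"
  by (subst linear_form_superset[of "{x}"]) auto

lemma linear_form_add: "linear_form f (p + q) = linear_form f p + linear_form f q"
proof -
  let ?A = "Poly_Mapping.keys p \<union> Poly_Mapping.keys q"
  show ?thesis
    using Poly_Mapping.keys_add[of p q]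
    by (simp add: linear_form_superset[of ?A] lookup_add distrib_right sum.distrib)
qed

lemma linear_form_scale: "linear_form f (scale c p) = c * linear_form f p"
  by (subst linear_form_superset[of "Poly_Mapping.keys p"])
     (auto simp: in_keys_iff linear_form_def sum_distrib_left mult.assoc)

lemma linear_form_diff: "linear_form f (p - q) = linear_form f p - linear_form f q"
  using linear_form_add[of f p "- q"] linear_form_scale[of f "- 1" q]
  by (simp add: scale_minus_one)

lemma linear_form_sum: "linear_form f (sum g A) = (\<Sum>x\<in>A. linear_form f (g x))"
  by (induction A rule: infinite_finite_induct) (simp_all add: linear_form_add)

lemma linear_extension_superset:
  assumes "finite A" "Poly_Mapping.keys p \<subseteq> A"
  shows "linear_extension f p = (\<Sum>x\<in>A. scale (Poly_Mapping.lookup p x) (f x))"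
  unfolding linear_extension_def using assms
  by (intro sum.mono_neutral_left) (auto simp: in_keys_iff)

lemma linear_extension_zero [simp]: "linear_extension f 0 = 0"
  by (simp add: linear_extension_def)

lemma linear_extension_single [simp]: "linear_extension f (Poly_Mapping.single x c) = scale c (f x)"
  by (subst linear_extension_superset[of "{x}"]) auto

lemma linear_extension_add:
  "linear_extension f (p + q) = linear_extension f p + linear_extension f q"
proof -
  let ?A = "Poly_Mapping.keys p \<union> Poly_Mapping.keys q"
  show ?thesis
    using Poly_Mapping.keys_add[of p q]
    by (simp add: linear_extension_superset[of ?A] lookup_add scale_add_left sum.distrib)
qed

lemma linear_extension_scale: "linear_extension f (scale c p) = scale c (linear_extension f p)"
  by (subst linear_extension_superset[of "Poly_Mapping.keys p"])
     (auto simp: in_keys_iff linear_extension_def scale_sum)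

lemma linear_extension_diff:
  "linear_extension f (p - q) = linear_extension f p - linear_extension f q"
  using linear_extension_add[of f p "- q"] linear_extension_scale[of f "- 1" q]
  by (simp add: scale_minus_one)

lemma linear_extension_sum:
  "linear_extension f (sum g A) = (\<Sum>x\<in>A. linear_extension f (g x))"
  by (induction A rule: infinite_finite_induct) (simp_all add: linear_extension_add)

lemma linear_extension_pointwise_add:
  "linear_extension (\<lambda>x. f x + g x) p = linear_extension f p + linear_extension g p"
  by (simp add: linear_extension_def scale_add sum.distrib)

lemma linear_extension_pointwise_scale:
  "linear_extension (\<lambda>x. scale c (f x)) p = scale c (linear_extension f p)"
  by (simp add: linear_extension_def scale_sum mult.commute)

lemmas linear_simps =
  linear_extension_add linear_extension_scale linear_extension_diff linear_extension_sum
  linear_form_add linear_form_scale linear_form_diff linear_form_sum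

lemma keys_scale: "Poly_Mapping.keys (scale c p) \<subseteq> Poly_Mapping.keys p"
  by (auto simp: in_keys_iff)

lemma keys_linear_extension:
  "Poly_Mapping.keys (linear_extension f p) \<subseteq> (\<Union>x\<in>Poly_Mapping.keys p. Poly_Mapping.keys (f x))"
proof -
  have "Poly_Mapping.keys (linear_extension f p)
      \<subseteq> (\<Union>x\<in>Poly_Mapping.keys p. Poly_Mapping.keys (scale (Poly_Mapping.lookup p x) (f x)))"
    unfolding linear_extension_def by (rule keys_sum)
  also have "\<dots> \<subseteq> (\<Union>x\<in>Poly_Mapping.keys p. Poly_Mapping.keys (f x))"
    using keys_scale by (intro UN_mono order.refl)
  finally show ?thesis .
qed

text \<open>
  A linear extension is multiplicative as soon as it is multiplicative on basis elements; the set
  \<open>X\<close> confines the requirement to a subsemigroup.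
\<close>

lemma linear_extension_mult:
  fixes f :: "'a::monoid_add \<Rightarrow> ('b::monoid_add \<Rightarrow>\<^sub>0 'k::field)"
  assumes f: "\<And>u v. u \<in> X \<Longrightarrow> v \<in> X \<Longrightarrow> f (u + v) = f u * f v"
    and "Poly_Mapping.keys p \<subseteq> X" "Poly_Mapping.keys q \<subseteq> X"
  shows "linear_extension f (p * q) = linear_extension f p * linear_extension f q"
  using assms(2)
proof (induction rule: span_induct_on)
  case (single u)
  from assms(3) show ?case
    by (induction rule: span_induct_on)
       (simp_all add: linear_simps distrib_left scale_mult_right mult_single f single)
qed (simp_all add: linear_simps distrib_right scale_mult_left)

lemma linear_extension_antimult:
  fixes f :: "'a::monoid_add \<Rightarrow> ('b::monoid_add \<Rightarrow>\<^sub>0 'k::field)"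
  assumes f: "\<And>u v. f (u + v) = f v * f u"
  shows "linear_extension f (p * q) = linear_extension f q * linear_extension f p"
  using subset_UNIV
proof (induction p rule: span_induct_on)
  case (single u)
  show ?case
    using subset_UNIV
    by (induction q rule: span_induct_on)
       (simp_all add: linear_simps distrib_right distrib_left scale_mult_left scale_mult_right
         mult_single f)
qed (simp_all add: linear_simps distrib_left distrib_right scale_mult_left scale_mult_right)


section \<open>Quotients of graded algebras with involution\<close>

text \<open>
  A bilinear multiplication and a linear involution are what makes the operations well defined on
  the cosets of an ideal, and the algebra on pairs of elements inherits both from its factors.
\<close>

locale star_algebra = abelian_group A
  for A :: "('k::field, 'a) graded_star_algebra" (structure) +
  assumes mult_closed: "x \<in> carrier A \<Longrightarrow> y \<in> carrier A \<Longrightarrow> x \<otimes> y \<in> carrier A"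
    and mult_add_left: "x \<in> carrier A \<Longrightarrow> x' \<in> carrier A \<Longrightarrow> y \<in> carrier A
      \<Longrightarrow> (x \<oplus> x') \<otimes> y = x \<otimes> y \<oplus> x' \<otimes> y"
    and mult_add_right: "x \<in> carrier A \<Longrightarrow> y \<in> carrier A \<Longrightarrow> y' \<in> carrier A
      \<Longrightarrow> x \<otimes> (y \<oplus> y') = x \<otimes> y \<oplus> x \<otimes> y'"
    and smult_closed: "x \<in> carrier A \<Longrightarrow> c \<odot> x \<in> carrier A"
    and smult_add: "x \<in> carrier A \<Longrightarrow> y \<in> carrier A \<Longrightarrow> c \<odot> (x \<oplus> y) = c \<odot> x \<oplus> c \<odot> y"
    and smult_add_left: "x \<in> carrier A \<Longrightarrow> (c + d) \<odot> x = c \<odot> x \<oplus> d \<odot> x"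
    and smult_smult: "x \<in> carrier A \<Longrightarrow> c \<odot> (d \<odot> x) = (c * d) \<odot> x"
    and smult_one: "x \<in> carrier A \<Longrightarrow> 1 \<odot> x = x"
    and smult_mult_left: "x \<in> carrier A \<Longrightarrow> y \<in> carrier A \<Longrightarrow> (c \<odot> x) \<otimes> y = c \<odot> (x \<otimes> y)"
    and smult_mult_right: "x \<in> carrier A \<Longrightarrow> y \<in> carrier A \<Longrightarrow> x \<otimes> (c \<odot> y) = c \<odot> (x \<otimes> y)"
    and star_closed: "x \<in> carrier A \<Longrightarrow> star A x \<in> carrier A"
    and star_add: "x \<in> carrier A \<Longrightarrow> y \<in> carrier A \<Longrightarrow> star A (x \<oplus> y) = star A x \<oplus> star A y"
    and star_smult: "x \<in> carrier A \<Longrightarrow> star A (c \<odot> x) = c \<odot> star A x"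
begin

lemma smult_zero_left:
  assumes "x \<in> carrier A" shows "0 \<odot> x = \<zero>"
proof -
  have "0 \<odot> x = \<ominus> (0 \<odot> x) \<oplus> (0 \<odot> x \<oplus> 0 \<odot> x)"
    using smult_closed[OF assms, of 0] by (simp add: r_neg1)
  also have "0 \<odot> x \<oplus> 0 \<odot> x = 0 \<odot> x"
    using smult_add_left[OF assms, of 0 0] by simp
  finally show ?thesis
    using smult_closed[OF assms, of 0] by (simp add: l_neg)
qed

lemma smult_minus_one:
  assumes "x \<in> carrier A" shows "(- 1) \<odot> x = \<ominus> x"
proof -
  have "(- 1) \<odot> x \<oplus> x = \<zero>"
    using smult_add_left[OF assms, of "- 1" 1] assms by (simp add: smult_one smult_zero_left)
  then show ?thesis
    using smult_closed[OF assms, of "- 1"] assms by (simp add: minus_equality)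
qed

lemma linear_subspaceI:
  assumes "U \<subseteq> carrier A" "\<zero> \<in> U"
    and "\<And>x y. x \<in> U \<Longrightarrow> y \<in> U \<Longrightarrow> x \<oplus> y \<in> U"
    and smult: "\<And>c x. x \<in> U \<Longrightarrow> c \<odot> x \<in> U"
  shows "linear_subspace A U"
proof -
  have "subgroup U (add_monoid A)"
  proof (rule add.subgroupI)
    fix x assume "x \<in> U"
    then show "\<ominus> x \<in> U"
      using smult[of x "- 1"] assms(1) by (auto simp: smult_minus_one)
  qed (use assms in auto)
  then show ?thesis
    using smult by (auto simp: linear_subspace_def intro: additive_subgroupI)
qed

end

locale star_ideal = star_algebra +
  fixes I
  assumes ideal: "algebra_ideal A I"
    and star_ideal: "x \<in> I \<Longrightarrow> star A x \<in> I"
begin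

sublocale sub: abelian_subgroup I A
  using ideal abelian_group_axioms
  by (intro abelian_subgroupI3) (auto simp: algebra_ideal_def linear_subspace_def)

lemma coset_iff: "y \<in> I +> x \<longleftrightarrow> (\<exists>h\<in>I. y = h \<oplus> x)"
  by (auto simp: a_r_coset_def')

lemma coset_eqI: "h \<in> I \<Longrightarrow> x \<in> carrier A \<Longrightarrow> I +> (h \<oplus> x) = I +> x"
  by (metis sub.a_repr_independence' coset_iff)

lemma coset_eq_iff:
  assumes "x \<in> carrier A" "y \<in> carrier A"
  shows "I +> x = I +> y \<longleftrightarrow> x \<ominus> y \<in> I"
  using assms sub.a_rcos_module[of y x] sub.a_rcos_self
  by (metis a_minus_def sub.a_repr_independence' sub.a_repr_independenceD)

lemma coset_zero: "I +> \<zero> = I"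
  using a_coset_join2 sub.additive_subgroup_axioms zero_closed
  by (metis a_coset_add_zero sub.a_subset)

text \<open>
  The operations on cosets are unions over all representatives. The following three lemmas show
  that every representative gives the same coset, so that the union is this one coset.
\<close>

lemma coset_mult:
  assumes x: "x \<in> carrier A" and y: "y \<in> carrier A"
  shows "[mod I:] (I +> x) \<Otimes> (I +> y) = I +> (x \<otimes> y)"
proof -
  have "I +> (a \<otimes> b) = I +> (x \<otimes> y)" if "a \<in> I +> x" "b \<in> I +> y" for a b
  proof -
    from that obtain h k where h: "h \<in> I" "a = h \<oplus> x" and k: "k \<in> I" "b = k \<oplus> y"
      by (auto simp: coset_iff)
    have hk: "h \<in> carrier A" "k \<in> carrier A"
      using h k by auto
    have cl: "h \<otimes> (k \<oplus> y) \<in> carrier A" "x \<otimes> k \<in> carrier A" "x \<otimes> y \<in> carrier A"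
      using hk x y by (auto intro: mult_closed)
    have "a \<otimes> b = h \<otimes> (k \<oplus> y) \<oplus> (x \<otimes> k \<oplus> x \<otimes> y)"
      using hk x y h k by (simp add: mult_add_left mult_add_right mult_closed a_ac)
    also have "\<dots> = (h \<otimes> (k \<oplus> y) \<oplus> x \<otimes> k) \<oplus> x \<otimes> y"
      using cl by (simp add: a_assoc)
    finally have eq: "a \<otimes> b = (h \<otimes> (k \<oplus> y) \<oplus> x \<otimes> k) \<oplus> x \<otimes> y" .
    have "h \<otimes> (k \<oplus> y) \<in> I" "x \<otimes> k \<in> I"
      using ideal h k hk x y by (auto simp: algebra_ideal_def)
    then show ?thesis
      unfolding eq by (intro coset_eqI cl) simp
  qed
  moreover have "I +> x \<noteq> {}" "I +> y \<noteq> {}"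
    using sub.a_rcos_self x y by auto
  ultimately show ?thesis
    unfolding rcoset_mult_def by (simp cong: SUP_cong_simp)
qed

lemma coset_smult:
  assumes x: "x \<in> carrier A"
  shows "(\<Union>a\<in>I +> x. I +> (c \<odot> a)) = I +> (c \<odot> x)"
proof -
  have "I +> (c \<odot> a) = I +> (c \<odot> x)" if "a \<in> I +> x" for a
  proof -
    from that obtain h where h: "h \<in> I" "a = h \<oplus> x"
      by (auto simp: coset_iff)
    have "c \<odot> h \<in> I"
      using ideal h by (auto simp: algebra_ideal_def linear_subspace_def)
    then show ?thesis
      using h x by (auto simp: smult_add coset_eqI smult_closed)
  qed
  moreover have "I +> x \<noteq> {}"
    using sub.a_rcos_self x by auto
  ultimately show ?thesis
    by (simp cong: SUP_cong_simp)
qed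

lemma coset_star:
  assumes x: "x \<in> carrier A"
  shows "(\<Union>a\<in>I +> x. I +> star A a) = I +> star A x"
proof -
  have "I +> star A a = I +> star A x" if "a \<in> I +> x" for a
  proof -
    from that obtain h where h: "h \<in> I" "a = h \<oplus> x"
      by (auto simp: coset_iff)
    then show ?thesis
      using x by (auto simp: star_add coset_eqI star_closed star_ideal)
  qed
  moreover have "I +> x \<noteq> {}"
    using sub.a_rcos_self x by auto
  ultimately show ?thesis
    by (simp cong: SUP_cong_simp)
qed

abbreviation Q where "Q \<equiv> quotient_algebra A I"

lemma carrier_quotient: "carrier Q = (\<lambda>x. I +> x) ` carrier A"
  by (auto simp: quotient_algebra_def FactRing_def A_RCOSETS_def')

lemma zero_quotient: "\<zero>\<^bsub>Q\<^esub> = I +> \<zero>"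
  by (simp only: quotient_algebra_def FactRing_def ring.simps coset_zero)

lemma component_quotient: "component Q n = (\<lambda>x. I +> x) ` component A n"
  by (simp add: quotient_algebra_def)

lemma quotient_ops:
  assumes "x \<in> carrier A"
  shows "y \<in> carrier A \<Longrightarrow> (I +> x) \<otimes>\<^bsub>Q\<^esub> (I +> y) = I +> (x \<otimes> y)"
    and "y \<in> carrier A \<Longrightarrow> (I +> x) \<oplus>\<^bsub>Q\<^esub> (I +> y) = I +> (x \<oplus> y)"
    and "c \<odot>\<^bsub>Q\<^esub> (I +> x) = I +> (c \<odot> x)"
    and "star Q (I +> x) = I +> star A x"
  using coset_mult[OF assms] sub.a_rcos_sum[OF assms] coset_smult[OF assms, of c] coset_star[OF assms]
  by (simp_all only: quotient_algebra_def FactRing_def graded_star_algebra.simps module.simps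
      ring.simps monoid.simps partial_object.simps)

lemmas quotient_simps = carrier_quotient zero_quotient component_quotient quotient_ops

lemma star_algebra_quotient: "star_algebra Q"
proof (intro star_algebra.intro star_algebra_axioms.intro)
  show "abelian_group Q"
  proof (rule abelian_groupI)
    fix X assume "X \<in> carrier Q"
    then obtain x where x: "x \<in> carrier A" "X = I +> x"
      by (auto simp only: carrier_quotient)
    then show "\<exists>Y\<in>carrier Q. Y \<oplus>\<^bsub>Q\<^esub> X = \<zero>\<^bsub>Q\<^esub>"
      by (intro bexI[of _ "I +> (\<ominus> x)"]) (simp_all add: quotient_simps l_neg)
  qed (use a_ac in \<open>auto simp: quotient_simps\<close>)
qed (auto simp: quotient_simps mult_closed mult_add_left mult_add_right smult_closed smult_add
    smult_add_left smult_smult smult_one smult_mult_left smult_mult_right star_closed star_add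
    star_smult)

end

text \<open>
  To embed one quotient algebra into another one, it suffices to find a homomorphism between the
  algebras above them for which the ideal of the source is exactly the preimage of the ideal of the
  target.
\<close>

lemma quotient_embedding:
  fixes A :: "('k::field, 'a) graded_star_algebra" and B :: "('k, 'b) graded_star_algebra"
  assumes "star_ideal A I" "star_ideal B J"
    and hom: "h \<in> algebra_hom A B"
    and preimage: "\<And>x. x \<in> carrier A \<Longrightarrow> h x \<in> J \<longleftrightarrow> x \<in> I"
    and star: "\<And>x. x \<in> carrier A \<Longrightarrow> h (star A x) = star B (h x)"
    and component: "\<And>n. component A n \<subseteq> carrier A" "\<And>n x. x \<in> component A n \<Longrightarrow> h x \<in> component B n"
  shows "\<exists>\<psi>. \<psi> \<in> algebra_hom (quotient_algebra A I) (quotient_algebra B J)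
    \<and> inj_on \<psi> (carrier (quotient_algebra A I))
    \<and> (\<forall>a\<in>carrier (quotient_algebra A I).
         \<psi> (star (quotient_algebra A I) a) = star (quotient_algebra B J) (\<psi> a))
    \<and> (\<forall>n. \<psi> ` component (quotient_algebra A I) n \<subseteq> component (quotient_algebra B J) n)"
proof -
  interpret A: star_ideal A I by fact
  interpret B: star_ideal B J by fact
  have cl: "h x \<in> carrier B" if "x \<in> carrier A" for x
    using hom that by (auto simp: algebra_hom_def hom_def)
  have h_mult: "h (x \<otimes>\<^bsub>A\<^esub> y) = h x \<otimes>\<^bsub>B\<^esub> h y"
    and h_add: "h (x \<oplus>\<^bsub>A\<^esub> y) = h x \<oplus>\<^bsub>B\<^esub> h y" if "x \<in> carrier A" "y \<in> carrier A" for x y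
    using hom that by (auto simp: algebra_hom_def hom_def)
  have h_smult: "h (c \<odot>\<^bsub>A\<^esub> x) = c \<odot>\<^bsub>B\<^esub> h x" if "x \<in> carrier A" for c x
    using hom that by (auto simp: algebra_hom_def)
  have h_minus: "h (x \<ominus>\<^bsub>A\<^esub> y) = h x \<ominus>\<^bsub>B\<^esub> h y" if "x \<in> carrier A" "y \<in> carrier A" for x y
    using that cl by (simp add: a_minus_def h_add h_smult flip: A.smult_minus_one B.smult_minus_one)
      (simp add: A.smult_closed h_add h_smult)
  have eq_iff: "J +>\<^bsub>B\<^esub> h x = J +>\<^bsub>B\<^esub> h y \<longleftrightarrow> I +>\<^bsub>A\<^esub> x = I +>\<^bsub>A\<^esub> y"
    if "x \<in> carrier A" "y \<in> carrier A" for x y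
    using that preimage by (simp add: A.coset_eq_iff B.coset_eq_iff cl flip: h_minus)
  define \<psi> where "\<psi> X = (SOME Y. \<exists>x\<in>carrier A. X = I +>\<^bsub>A\<^esub> x \<and> Y = J +>\<^bsub>B\<^esub> h x)" for X
  have \<psi>: "\<psi> (I +>\<^bsub>A\<^esub> x) = J +>\<^bsub>B\<^esub> h x" if "x \<in> carrier A" for x
  proof -
    have "\<exists>x'\<in>carrier A. I +>\<^bsub>A\<^esub> x = I +>\<^bsub>A\<^esub> x' \<and> \<psi> (I +>\<^bsub>A\<^esub> x) = J +>\<^bsub>B\<^esub> h x'"
      unfolding \<psi>_def by (rule someI_ex) (use that in blast)
    then show ?thesis
      using that by (metis eq_iff)
  qed
  show ?thesis
  proof (intro exI[of _ \<psi>] conjI ballI allI)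
    show "\<psi> \<in> algebra_hom A.Q B.Q"
      by (auto simp: algebra_hom_def hom_def A.quotient_simps B.quotient_simps \<psi> cl h_mult h_add
          h_smult A.mult_closed A.smult_closed)
    show "inj_on \<psi> (carrier A.Q)"
      by (auto simp: inj_on_def A.quotient_simps \<psi> eq_iff)
    show "\<psi> (star A.Q a) = star B.Q (\<psi> a)" if "a \<in> carrier A.Q" for a
      using that by (auto simp: A.quotient_simps B.quotient_simps \<psi> cl star A.star_closed)
    show "\<psi> ` component A.Q n \<subseteq> component B.Q n" for n
      using component by (force simp: A.quotient_simps B.quotient_simps \<psi>)
  qed
qed


section \<open>Subspaces and ideals generated by relators\<close>

context star_algebra begin

lemma linear_subspace_iff:
  "linear_subspace A U \<longleftrightarrow> U \<subseteq> carrier A \<and> \<zero> \<in> U \<and> (\<forall>x\<in>U. \<forall>y\<in>U. x \<oplus> y \<in> U)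
     \<and> (\<forall>c. \<forall>x\<in>U. c \<odot> x \<in> U)" (is "_ \<longleftrightarrow> ?R")
proof
  assume U: "linear_subspace A U"
  then interpret additive_subgroup U A by (simp add: linear_subspace_def)
  show ?R using U a_subset by (auto simp: linear_subspace_def)
qed (auto intro: linear_subspaceI)

lemma star_zero: "star A \<zero> = \<zero>"
  using star_smult[of \<zero> 0] star_closed[of \<zero>] by (simp add: smult_zero_left)

lemma linear_span_subspace:
  assumes "S \<subseteq> carrier A"
  shows "linear_subspace A (linear_span A S)"
proof -
  have "linear_subspace A (carrier A)"
    by (intro linear_subspaceI) (auto intro: smult_closed)
  then show ?thesis
    unfolding linear_span_def using assms
    by (subst linear_subspace_iff) (auto simp: linear_subspace_iff)
qed

lemma linear_span_superset: "S \<subseteq> linear_span A S"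
  by (auto simp: linear_span_def)

lemma linear_span_minimal: "linear_subspace A U \<Longrightarrow> S \<subseteq> U \<Longrightarrow> linear_span A S \<subseteq> U"
  by (auto simp: linear_span_def)

lemma ideal_generated_ideal:
  assumes "S \<subseteq> carrier A"
  shows "algebra_ideal A (ideal_generated A S)"
proof -
  have "algebra_ideal A (carrier A)"
    by (auto simp: algebra_ideal_def linear_subspace_iff smult_closed mult_closed)
  then show ?thesis
    unfolding ideal_generated_def using assms
    by (subst algebra_ideal_def, subst linear_subspace_iff)
       (auto simp: algebra_ideal_def linear_subspace_iff)
qed

lemma ideal_generated_superset: "S \<subseteq> ideal_generated A S"
  by (auto simp: ideal_generated_def)

lemma ideal_generated_minimal: "algebra_ideal A I \<Longrightarrow> S \<subseteq> I \<Longrightarrow> ideal_generated A S \<subseteq> I"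
  by (auto simp: ideal_generated_def)

text \<open>
  The elements of the ideal whose adjoint lies in the ideal form an ideal themselves, because the
  involution reverses products.
\<close>

lemma star_ideal_generated:
  assumes S: "S \<subseteq> carrier A" and star_S: "\<And>x. x \<in> S \<Longrightarrow> star A x \<in> S"
    and anti: "\<And>x y. x \<in> carrier A \<Longrightarrow> y \<in> carrier A \<Longrightarrow> star A (x \<otimes> y) = star A y \<otimes> star A x"
  shows "star_ideal A (ideal_generated A S)"
proof -
  let ?I = "ideal_generated A S"
  have I: "algebra_ideal A ?I"
    using S by (rule ideal_generated_ideal)
  then have sub: "?I \<subseteq> carrier A"
    by (simp add: algebra_ideal_def linear_subspace_iff)
  have "algebra_ideal A {x \<in> ?I. star A x \<in> ?I}"
    using I sub unfolding algebra_ideal_def linear_subspace_iff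
    by (auto simp: star_zero star_add star_smult anti star_closed subset_iff)
  then have "?I \<subseteq> {x \<in> ?I. star A x \<in> ?I}"
    using star_S ideal_generated_superset by (intro ideal_generated_minimal) auto
  with I show ?thesis
    by unfold_locales auto
qed

end


section \<open>Word algebras\<close>

abbreviation word :: "'g list \<Rightarrow> ('g list \<Rightarrow>\<^sub>0 'k::field)" where
  "word w \<equiv> Poly_Mapping.single w 1"

lemma word_mult [simp]: "word u * word v = word (u @ v)"
  by (simp add: mult_single plus_list_def)

lemma word_Nil: "word [] = 1"
  by (metis single_one zero_list_def)

lemma word_algebra_simps [simp]:
  "carrier (word_algebra W st deg) = {p. Poly_Mapping.keys p \<subseteq> W}"
  "p \<otimes>\<^bsub>word_algebra W st deg\<^esub> q = p * q"
  "\<one>\<^bsub>word_algebra W st deg\<^esub> = 1"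
  "\<zero>\<^bsub>word_algebra W st deg\<^esub> = 0"
  "p \<oplus>\<^bsub>word_algebra W st deg\<^esub> q = p + q"
  "c \<odot>\<^bsub>word_algebra W st deg\<^esub> p = scale c p"
  "star (word_algebra W st deg) = linear_extension (\<lambda>w. word (rev (map st w)))"
  "component (word_algebra W st deg) n
     = {p. \<forall>w\<in>Poly_Mapping.keys p. w \<in> W \<and> sum_list (map deg w) = n}"
  by (simp_all add: word_algebra_def)

lemma keys_word_mult:
  fixes p q :: "'g list \<Rightarrow>\<^sub>0 'k::field"
  assumes "\<And>u v. u \<in> W \<Longrightarrow> v \<in> W' \<Longrightarrow> u @ v \<in> W''"
    and "Poly_Mapping.keys p \<subseteq> W" "Poly_Mapping.keys q \<subseteq> W'"
  shows "Poly_Mapping.keys (p * q) \<subseteq> W''"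
  using keys_mult[of p q] assms by (force simp: plus_list_def)

lemma star_algebra_word_algebra:
  fixes W :: "'g list set"
  assumes app: "\<And>u v. u \<in> W \<Longrightarrow> v \<in> W \<Longrightarrow> u @ v \<in> W"
    and rev: "\<And>w. w \<in> W \<Longrightarrow> rev (map st w) \<in> W"
  shows "star_algebra (word_algebra W st deg :: ('k::field, 'g list \<Rightarrow>\<^sub>0 'k) graded_star_algebra)"
    (is "star_algebra ?A")
proof (intro star_algebra.intro star_algebra_axioms.intro)
  show "abelian_group (?A)"
  proof (rule abelian_groupI)
    fix p :: "'g list \<Rightarrow>\<^sub>0 'k"
    assume "p \<in> carrier (?A)"
    then show "\<exists>q\<in>carrier (?A).
        q \<oplus>\<^bsub>?A\<^esub> p = \<zero>\<^bsub>?A\<^esub>"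
      by (intro bexI[of _ "- p"]) auto
  qed (use Poly_Mapping.keys_add in \<open>force simp: ac_simps\<close>)+
next
  fix p q :: "'g list \<Rightarrow>\<^sub>0 'k"
  assume "p \<in> carrier (?A)" "q \<in> carrier (?A)"
  then show "p \<otimes>\<^bsub>?A\<^esub> q \<in> carrier (?A)"
    using keys_word_mult[OF app] by simp
next
  fix p :: "'g list \<Rightarrow>\<^sub>0 'k"
  assume "p \<in> carrier (?A)"
  then show "star (?A) p \<in> carrier (?A)"
    using keys_linear_extension[of "\<lambda>w. word (rev (map st w))" p] rev by fastforce
next
  fix p :: "'g list \<Rightarrow>\<^sub>0 'k" and c
  assume "p \<in> carrier (?A)"
  then show "c \<odot>\<^bsub>?A\<^esub> p \<in> carrier (?A)"
    using keys_scale[of c p] by auto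
qed (simp_all add: distrib_left distrib_right scale_add scale_add_left scale_mult_left
    scale_mult_right linear_simps)

lemma star_word_algebra_mult:
  "star (word_algebra W st deg) (p * q)
     = star (word_algebra W st deg) q * star (word_algebra W st deg) p"
  unfolding word_algebra_simps by (rule linear_extension_antimult) (simp add: plus_list_def)


section \<open>Presentations of the two Leavitt algebras\<close>

definition free_l12 :: "('k::field, l12_gen list \<Rightarrow>\<^sub>0 'k) graded_star_algebra" where
  "free_l12 = word_algebra UNIV l12_gen_star l12_gen_deg"

abbreviation l12_ideal :: "(l12_gen list \<Rightarrow>\<^sub>0 'k::field) set" where
  "l12_ideal \<equiv> ideal_generated free_l12 l12_relators"

lemmas free_l12_simps [simp] =
  word_algebra_simps[of UNIV l12_gen_star l12_gen_deg, folded free_l12_def]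

lemma leavitt_algebra_1_2_eq: "leavitt_algebra_1_2 K = quotient_algebra free_l12 l12_ideal"
  by (simp add: leavitt_algebra_1_2_def free_l12_def Let_def)

lemma star_ideal_l12: "star_ideal (free_l12 :: ('k::field, _) graded_star_algebra) l12_ideal"
proof -
  interpret star_algebra "free_l12 :: ('k, _) graded_star_algebra"
    unfolding free_l12_def by (rule star_algebra_word_algebra) auto
  show ?thesis
  proof (rule star_ideal_generated)
    show "star free_l12 x \<in> l12_relators" if "x \<in> l12_relators" for x :: "l12_gen list \<Rightarrow>\<^sub>0 'k"
      using that
      by (auto simp: l12_relators_def gen_def linear_simps simp flip: word_Nil)
    show "star free_l12 (x \<otimes>\<^bsub>free_l12\<^esub> y) = star free_l12 y \<otimes>\<^bsub>free_l12\<^esub> star free_l12 x"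
      for x y :: "l12_gen list \<Rightarrow>\<^sub>0 'k"
      unfolding free_l12_def by (simp only: word_algebra_simps(2) star_word_algebra_mult)
  qed simp
qed

definition free_lpa ::
    "('v, 'e) pre_digraph \<Rightarrow> ('k::field, ('v, 'e) lpa_gen list \<Rightarrow>\<^sub>0 'k) graded_star_algebra" where
  "free_lpa E = word_algebra (lists (lpa_gens E) - {[]}) lpa_gen_star lpa_gen_deg"

abbreviation lpa_ideal :: "('v, 'e) pre_digraph \<Rightarrow> (('v, 'e) lpa_gen list \<Rightarrow>\<^sub>0 'k::field) set" where
  "lpa_ideal E \<equiv> ideal_generated (free_lpa E) (lpa_relators E)"

lemmas free_lpa_simps [simp] =
  word_algebra_simps[of "lists (lpa_gens E) - {[]}" lpa_gen_star lpa_gen_deg, folded free_lpa_def]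
  for E

lemma leavitt_path_algebra_eq:
  "leavitt_path_algebra K E = quotient_algebra (free_lpa E) (lpa_ideal E)"
  by (simp add: leavitt_path_algebra_def free_lpa_def Let_def)

lemma lpa_gen_star_in_gens: "g \<in> lpa_gens E \<Longrightarrow> lpa_gen_star g \<in> lpa_gens E"
  by (auto simp: lpa_gens_def)

lemma star_algebra_free_lpa: "star_algebra (free_lpa E)"
  unfolding free_lpa_def
  by (rule star_algebra_word_algebra) (auto simp: lpa_gen_star_in_gens in_lists_conv_set)

lemma lpa_relators_cases [consumes 1]:
  assumes "x \<in> (lpa_relators E :: (('v, 'e) lpa_gen list \<Rightarrow>\<^sub>0 'k::field) set)"
  obtains
    (vertices) v w where "v \<in> verts E" "w \<in> verts E"
      "x = word [Vertex v, Vertex w] - (if v = w then word [Vertex w] else 0)"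
  | (tail_edge) e where "e \<in> arcs E" "x = word [Vertex (tail E e), Edge e] - word [Edge e]"
  | (edge_head) e where "e \<in> arcs E" "x = word [Edge e, Vertex (head E e)] - word [Edge e]"
  | (head_ghost) e where "e \<in> arcs E" "x = word [Vertex (head E e), Ghost e] - word [Ghost e]"
  | (ghost_tail) e where "e \<in> arcs E" "x = word [Ghost e, Vertex (tail E e)] - word [Ghost e]"
  | (ghost_edge) e f where "e \<in> arcs E" "f \<in> arcs E"
      "x = word [Ghost e, Edge f] - (if e = f then word [Vertex (head E e)] else 0)"
  | (cuntz_krieger) v where "regular_vertex E v"
      "x = word [Vertex v] - (\<Sum>e\<in>out_arcs E v. word [Edge e, Ghost e])"
  using assms unfolding lpa_relators_def gen_def word_mult append_Cons append_Nil
  by blast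

lemma lpa_relatorsI:
  "v \<in> verts E \<Longrightarrow> w \<in> verts E \<Longrightarrow>
     word [Vertex v, Vertex w] - (if v = w then word [Vertex w] else 0) \<in> lpa_relators E"
  "e \<in> arcs E \<Longrightarrow> word [Vertex (tail E e), Edge e] - word [Edge e] \<in> lpa_relators E"
  "e \<in> arcs E \<Longrightarrow> word [Edge e, Vertex (head E e)] - word [Edge e] \<in> lpa_relators E"
  "e \<in> arcs E \<Longrightarrow> word [Vertex (head E e), Ghost e] - word [Ghost e] \<in> lpa_relators E"
  "e \<in> arcs E \<Longrightarrow> word [Ghost e, Vertex (tail E e)] - word [Ghost e] \<in> lpa_relators E"
  "e \<in> arcs E \<Longrightarrow> f \<in> arcs E \<Longrightarrow>
     word [Ghost e, Edge f] - (if e = f then word [Vertex (head E e)] else 0) \<in> lpa_relators E"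
  "regular_vertex E v \<Longrightarrow>
     word [Vertex v] - (\<Sum>e\<in>out_arcs E v. word [Edge e, Ghost e]) \<in> lpa_relators E"
  unfolding lpa_relators_def gen_def word_mult append_Cons append_Nil
  by blast+

lemma lpa_relators_in_carrier:
  assumes "wf_digraph E"
  shows "lpa_relators E \<subseteq> carrier (free_lpa E)"
proof
  interpret wf_digraph E by fact
  let ?W = "lists (lpa_gens E) - {[]}"
  have diff: "Poly_Mapping.keys (p - q) \<subseteq> ?W"
    if "Poly_Mapping.keys p \<subseteq> ?W" and "Poly_Mapping.keys q \<subseteq> ?W"
    for p q :: "('a, 'b) lpa_gen list \<Rightarrow>\<^sub>0 'k::field"
    using keys_diff[of p q] that by blast
  fix x :: "('a, 'b) lpa_gen list \<Rightarrow>\<^sub>0 'k::field"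
  assume "x \<in> lpa_relators E"
  then show "x \<in> carrier (free_lpa E)"
  proof (cases rule: lpa_relators_cases)
    case (cuntz_krieger v)
    have "Poly_Mapping.keys (\<Sum>e\<in>out_arcs E v. word [Edge e, Ghost e] :: _ \<Rightarrow>\<^sub>0 'k) \<subseteq> ?W"
      using keys_sum[of "\<lambda>e. word [Edge e, Ghost e] :: _ \<Rightarrow>\<^sub>0 'k" "out_arcs E v"]
      by (force simp: lpa_gens_def)
    moreover have "Poly_Mapping.keys (word [Vertex v] :: _ \<Rightarrow>\<^sub>0 'k) \<subseteq> ?W"
      using cuntz_krieger by (simp add: regular_vertex_def lpa_gens_def)
    ultimately show ?thesis
      unfolding cuntz_krieger free_lpa_simps mem_Collect_eq by (intro diff)
  qed (simp only: free_lpa_simps mem_Collect_eq,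
      (rule diff; simp add: lpa_gens_def image_iff))+
qed

lemma star_lpa_relators:
  assumes "x \<in> lpa_relators E"
  shows "star (free_lpa E) x \<in> lpa_relators E"
  using assms
proof (cases rule: lpa_relators_cases)
  case (vertices v w)
  then show ?thesis
    using lpa_relatorsI(1)[of w E v] by (auto simp: linear_simps)
next
  case (ghost_edge e f)
  then show ?thesis
    using lpa_relatorsI(6)[of f E e] by (auto simp: linear_simps)
qed (simp_all add: linear_simps lpa_relatorsI)

lemma star_ideal_lpa:
  assumes "wf_digraph E"
  shows "star_ideal (free_lpa E) (lpa_ideal E)"
proof -
  interpret star_algebra "free_lpa E" by (rule star_algebra_free_lpa)
  show ?thesis
    using lpa_relators_in_carrier[OF assms] star_lpa_relators
  proof (rule star_ideal_generated)
    show "star (free_lpa E) (x \<otimes>\<^bsub>free_lpa E\<^esub> y)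
        = star (free_lpa E) y \<otimes>\<^bsub>free_lpa E\<^esub> star (free_lpa E) x" for x y
      unfolding free_lpa_def by (simp only: word_algebra_simps(2) star_word_algebra_mult)
  qed
qed


section \<open>The tensor product\<close>

locale star_algebra_pair = A: star_algebra A + B: star_algebra B
  for A :: "('k::field, 'a) graded_star_algebra" and B :: "('k, 'b) graded_star_algebra"
begin

abbreviation P where "P \<equiv> pair_algebra A B"

abbreviation bilin where "bilin \<equiv> linear_span P (bilinearity_relators A B)"

lemma pair_algebra_simps:
  "carrier P = {p. Poly_Mapping.keys p \<subseteq> carrier A \<times> carrier B}"
  "\<zero>\<^bsub>P\<^esub> = 0"
  "p \<oplus>\<^bsub>P\<^esub> q = p + q"
  "c \<odot>\<^bsub>P\<^esub> p = scale c p"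
  "p \<otimes>\<^bsub>P\<^esub> q = linear_extension (\<lambda>x. linear_extension
     (\<lambda>y. pair (fst x \<otimes>\<^bsub>A\<^esub> fst y) (snd x \<otimes>\<^bsub>B\<^esub> snd y)) q) p"
  "star P = linear_extension (\<lambda>x. pair (star A (fst x)) (star B (snd x)))"
  "component P n = {p. \<forall>x\<in>Poly_Mapping.keys p.
     \<exists>i j. i + j = n \<and> fst x \<in> component A i \<and> snd x \<in> component B j}"
  by (simp_all add: pair_algebra_def split_def)

lemma mult_linear:
  "(p + p') \<otimes>\<^bsub>P\<^esub> q = p \<otimes>\<^bsub>P\<^esub> q + p' \<otimes>\<^bsub>P\<^esub> q"
  "p \<otimes>\<^bsub>P\<^esub> (q + q') = p \<otimes>\<^bsub>P\<^esub> q + p \<otimes>\<^bsub>P\<^esub> q'"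
  "scale c p \<otimes>\<^bsub>P\<^esub> q = scale c (p \<otimes>\<^bsub>P\<^esub> q)"
  "p \<otimes>\<^bsub>P\<^esub> scale c q = scale c (p \<otimes>\<^bsub>P\<^esub> q)"
  "0 \<otimes>\<^bsub>P\<^esub> q = 0" "p \<otimes>\<^bsub>P\<^esub> 0 = 0"
  by (simp_all add: pair_algebra_simps linear_simps linear_extension_pointwise_add
      linear_extension_pointwise_scale) (simp add: linear_extension_def)

lemma mult_diff:
  "(p - p') \<otimes>\<^bsub>P\<^esub> q = p \<otimes>\<^bsub>P\<^esub> q - p' \<otimes>\<^bsub>P\<^esub> q"
  "p \<otimes>\<^bsub>P\<^esub> (q - q') = p \<otimes>\<^bsub>P\<^esub> q - p \<otimes>\<^bsub>P\<^esub> q'"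
  using mult_linear(1)[of p "- p'" q] mult_linear(3)[of "- 1" p' q]
    mult_linear(2)[of p q "- q'"] mult_linear(4)[of p "- 1" q']
  by (simp_all add: scale_minus_one)

lemma mult_pair: "pair a b \<otimes>\<^bsub>P\<^esub> pair a' b' = pair (a \<otimes>\<^bsub>A\<^esub> a') (b \<otimes>\<^bsub>B\<^esub> b')"
  by (simp add: pair_algebra_simps)

lemma star_pair: "star P (pair a b) = pair (star A a) (star B b)"
  by (simp add: pair_algebra_simps)

lemma pair_carrier: "a \<in> carrier A \<Longrightarrow> b \<in> carrier B \<Longrightarrow> pair a b \<in> carrier P"
  by (simp add: pair_algebra_simps)

lemma carrier_induct [consumes 1, case_names zero add scale pair]:
  assumes "p \<in> carrier P" and "Q 0"
    and "\<And>p q. Q p \<Longrightarrow> Q q \<Longrightarrow> Q (p + q)"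
    and "\<And>c p. Q p \<Longrightarrow> Q (scale c p)"
    and pair: "\<And>a b. a \<in> carrier A \<Longrightarrow> b \<in> carrier B \<Longrightarrow> Q (pair a b)"
  shows "Q p"
proof -
  have "Poly_Mapping.keys p \<subseteq> carrier A \<times> carrier B"
    using assms(1) by (simp add: pair_algebra_simps)
  then show ?thesis
    by (induction rule: span_induct_on) (use assms in auto)
qed

lemma carrier_closed:
  "0 \<in> carrier P"
  "p \<in> carrier P \<Longrightarrow> q \<in> carrier P \<Longrightarrow> p + q \<in> carrier P"
  "p \<in> carrier P \<Longrightarrow> q \<in> carrier P \<Longrightarrow> p - q \<in> carrier P"
  "p \<in> carrier P \<Longrightarrow> - p \<in> carrier P"
  "p \<in> carrier P \<Longrightarrow> scale c p \<in> carrier P"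
  using Poly_Mapping.keys_add[of p q] keys_diff[of p q] keys_scale[of c p]
  by (auto simp: pair_algebra_simps)

lemma mult_carrier:
  assumes "p \<in> carrier P" "q \<in> carrier P"
  shows "p \<otimes>\<^bsub>P\<^esub> q \<in> carrier P"
  using assms(1)
proof (induction rule: carrier_induct)
  case (pair a b)
  from assms(2) show ?case
    by (induction rule: carrier_induct)
       (simp_all add: mult_linear carrier_closed mult_pair pair_carrier A.mult_closed B.mult_closed pair)
qed (simp_all add: mult_linear carrier_closed)

lemma star_carrier: "p \<in> carrier P \<Longrightarrow> star P p \<in> carrier P"
proof (induction rule: carrier_induct)
  case (pair a b)
  then show ?case
    by (simp add: star_pair pair_carrier A.star_closed B.star_closed)
qed (use carrier_closed in \<open>simp_all add: pair_algebra_simps(6) linear_simps\<close>)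

sublocale P: star_algebra P
proof (intro star_algebra.intro star_algebra_axioms.intro)
  show "abelian_group P"
  proof (rule abelian_groupI)
    fix p assume "p \<in> carrier P"
    then show "\<exists>q\<in>carrier P. q \<oplus>\<^bsub>P\<^esub> p = \<zero>\<^bsub>P\<^esub>"
      by (intro bexI[of _ "- p"]) (auto simp: carrier_closed pair_algebra_simps(2,3))
  qed (auto simp: pair_algebra_simps(2,3) carrier_closed ac_simps)
qed (auto simp: pair_algebra_simps(2,3,4) carrier_closed mult_carrier star_carrier mult_linear
    scale_add scale_add_left, simp_all add: pair_algebra_simps(6) linear_simps)

lemma bilinearity_relatorsI:
  "a \<in> carrier A \<Longrightarrow> a' \<in> carrier A \<Longrightarrow> b \<in> carrier B \<Longrightarrow>
     pair (a \<oplus>\<^bsub>A\<^esub> a') b - pair a b - pair a' b \<in> bilinearity_relators A B"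
  "a \<in> carrier A \<Longrightarrow> b \<in> carrier B \<Longrightarrow> b' \<in> carrier B \<Longrightarrow>
     pair a (b \<oplus>\<^bsub>B\<^esub> b') - pair a b - pair a b' \<in> bilinearity_relators A B"
  "a \<in> carrier A \<Longrightarrow> b \<in> carrier B \<Longrightarrow>
     pair (c \<odot>\<^bsub>A\<^esub> a) b - scale c (pair a b) \<in> bilinearity_relators A B"
  "a \<in> carrier A \<Longrightarrow> b \<in> carrier B \<Longrightarrow>
     pair a (c \<odot>\<^bsub>B\<^esub> b) - scale c (pair a b) \<in> bilinearity_relators A B"
  unfolding bilinearity_relators_def by blast+

lemma bilinearity_relators_cases [consumes 1]:
  assumes "x \<in> bilinearity_relators A B"
  obtains
    (add_left) a a' b where "a \<in> carrier A" "a' \<in> carrier A" "b \<in> carrier B"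
      "x = pair (a \<oplus>\<^bsub>A\<^esub> a') b - pair a b - pair a' b"
  | (add_right) a b b' where "a \<in> carrier A" "b \<in> carrier B" "b' \<in> carrier B"
      "x = pair a (b \<oplus>\<^bsub>B\<^esub> b') - pair a b - pair a b'"
  | (smult_left) c a b where "a \<in> carrier A" "b \<in> carrier B"
      "x = pair (c \<odot>\<^bsub>A\<^esub> a) b - scale c (pair a b)"
  | (smult_right) c a b where "a \<in> carrier A" "b \<in> carrier B"
      "x = pair a (c \<odot>\<^bsub>B\<^esub> b) - scale c (pair a b)"
  using assms that unfolding bilinearity_relators_def Un_iff mem_Collect_eq
  by (elim disjE exE conjE) metis+

lemma bilinearity_relators_carrier: "bilinearity_relators A B \<subseteq> carrier P"
proof
  fix x assume "x \<in> bilinearity_relators A B"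
  then show "x \<in> carrier P"
    by (cases rule: bilinearity_relators_cases)
       (auto simp del: scale_single
         intro!: carrier_closed(3,5) pair_carrier A.smult_closed B.smult_closed)
qed

lemma bilin_subspace: "linear_subspace P bilin"
  by (rule P.linear_span_subspace[OF bilinearity_relators_carrier])

lemma bilin_closed:
  "0 \<in> bilin" "p \<in> bilin \<Longrightarrow> q \<in> bilin \<Longrightarrow> p + q \<in> bilin" "p \<in> bilin \<Longrightarrow> scale c p \<in> bilin"
  using bilin_subspace unfolding P.linear_subspace_iff by (auto simp: pair_algebra_simps(2,3,4))

lemma bilin_diff:
  assumes "p \<in> bilin" "q \<in> bilin"
  shows "p - q \<in> bilin"
  using bilin_closed(2)[OF assms(1) bilin_closed(3)[OF assms(2), of "- 1"]]
  by (simp add: scale_minus_one)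

lemma bilin_relator: "x \<in> bilinearity_relators A B \<Longrightarrow> x \<in> bilin"
  using P.linear_span_superset by blast

lemma bilinearity_relators_mult:
  assumes "x \<in> bilinearity_relators A B" and ab: "a0 \<in> carrier A" "b0 \<in> carrier B"
  shows "pair a0 b0 \<otimes>\<^bsub>P\<^esub> x \<in> bilinearity_relators A B"
    and "x \<otimes>\<^bsub>P\<^esub> pair a0 b0 \<in> bilinearity_relators A B"
  using assms(1)
  by (cases rule: bilinearity_relators_cases;
      use ab in \<open>simp add: mult_diff mult_linear mult_pair A.mult_add_left A.mult_add_right
        A.smult_mult_left A.smult_mult_right B.mult_add_left B.mult_add_right B.smult_mult_left
        B.smult_mult_right A.mult_closed B.mult_closed bilinearity_relatorsI del: scale_single\<close>)+

lemma bilinearity_relators_star: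
  assumes "x \<in> bilinearity_relators A B"
  shows "star P x \<in> bilinearity_relators A B"
  using assms
  by (cases rule: bilinearity_relators_cases)
     (auto simp: pair_algebra_simps(6) linear_simps A.star_add A.star_smult B.star_add B.star_smult
       intro!: bilinearity_relatorsI[simplified] A.star_closed B.star_closed)

text \<open>
  The span of the relators is an ideal because multiplying a relator by a basis element gives
  another relator, and the basis elements span the algebra.
\<close>

lemma bilin_ideal: "algebra_ideal P bilin"
proof -
  let ?U = "{x \<in> bilin. \<forall>a\<in>carrier A. \<forall>b\<in>carrier B.
      pair a b \<otimes>\<^bsub>P\<^esub> x \<in> bilin \<and> x \<otimes>\<^bsub>P\<^esub> pair a b \<in> bilin}"
  have "linear_subspace P ?U"
    using bilin_subspace unfolding P.linear_subspace_iff
    by (auto simp: pair_algebra_simps(2,3,4) mult_linear bilin_closed)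
  then have U: "bilin \<subseteq> ?U"
    using bilin_relator bilinearity_relators_mult by (intro P.linear_span_minimal) auto
  have "p \<otimes>\<^bsub>P\<^esub> x \<in> bilin \<and> x \<otimes>\<^bsub>P\<^esub> p \<in> bilin" if "p \<in> carrier P" "x \<in> bilin" for p x
    using that(1)
    by (induction rule: carrier_induct) (use that(2) U in \<open>auto simp: mult_linear bilin_closed\<close>)
  then show ?thesis
    using bilin_subspace by (simp add: algebra_ideal_def)
qed

lemma star_ideal_bilin: "star_ideal P bilin"
proof (intro star_ideal.intro star_ideal_axioms.intro)
  have "linear_subspace P {x \<in> bilin. star P x \<in> bilin}"
    using bilin_subspace unfolding P.linear_subspace_iff
    by (auto simp: pair_algebra_simps(2,3,4,6) linear_simps bilin_closed)
  then have "bilin \<subseteq> {x \<in> bilin. star P x \<in> bilin}"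
    using bilin_relator bilinearity_relators_star by (intro P.linear_span_minimal) auto
  then show "star P x \<in> bilin" if "x \<in> bilin" for x
    using that by blast
qed (fact P.star_algebra_axioms bilin_ideal)+

text \<open>
  The product of a linear form on each factor is bilinear, hence it descends to the tensor
  product.
\<close>

lemma linear_form_bilin:
  assumes f: "\<And>a a'. a \<in> carrier A \<Longrightarrow> a' \<in> carrier A \<Longrightarrow> f (a \<oplus>\<^bsub>A\<^esub> a') = f a + f a'"
    "\<And>c a. a \<in> carrier A \<Longrightarrow> f (c \<odot>\<^bsub>A\<^esub> a) = c * f a"
    and g: "\<And>b b'. b \<in> carrier B \<Longrightarrow> b' \<in> carrier B \<Longrightarrow> g (b \<oplus>\<^bsub>B\<^esub> b') = g b + g b'"
    "\<And>c b. b \<in> carrier B \<Longrightarrow> g (c \<odot>\<^bsub>B\<^esub> b) = c * g b"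
    and x: "x \<in> bilin"
  shows "linear_form (\<lambda>y. f (fst y) * g (snd y)) x = 0"
proof -
  let ?F = "linear_form (\<lambda>y. f (fst y) * g (snd y))"
  have "linear_subspace P {x \<in> bilin. ?F x = 0}"
    using bilin_subspace unfolding P.linear_subspace_iff
    by (auto simp: pair_algebra_simps(2,3,4) linear_simps bilin_closed)
  moreover have "?F x = 0" if "x \<in> bilinearity_relators A B" for x
    using that
    by (cases rule: bilinearity_relators_cases; hypsubst; simp add: linear_simps f g algebra_simps)
  ultimately have "bilin \<subseteq> {x \<in> bilin. ?F x = 0}"
    using bilin_relator by (intro P.linear_span_minimal) auto
  then show ?thesis
    using x by blast
qed

end


section \<open>Ideals of rings as congruences\<close>

locale ring_ideal =
  fixes N :: "'a::ring_1 set"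
  assumes zero_mem: "0 \<in> N"
    and diff_mem: "a \<in> N \<Longrightarrow> b \<in> N \<Longrightarrow> a - b \<in> N"
    and left_mem: "a \<in> N \<Longrightarrow> c * a \<in> N"
    and right_mem: "a \<in> N \<Longrightarrow> a * c \<in> N"
begin

definition cong (infix \<open>\<approx>\<close> 50) where "a \<approx> b \<longleftrightarrow> a - b \<in> N"

lemma cong_zero_iff: "a \<approx> 0 \<longleftrightarrow> a \<in> N"
  by (simp add: cong_def)

lemma cong_refl [simp]: "a \<approx> a"
  by (simp add: cong_def zero_mem)

lemma add_mem: "a \<in> N \<Longrightarrow> b \<in> N \<Longrightarrow> a + b \<in> N"
  using diff_mem[of a "0 - b"] diff_mem[of 0 b] zero_mem by simp

lemma cong_sym: "a \<approx> b \<Longrightarrow> b \<approx> a"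
  using diff_mem[of 0 "a - b"] zero_mem by (simp add: cong_def)

lemma cong_trans [trans]: "a \<approx> b \<Longrightarrow> b \<approx> c \<Longrightarrow> a \<approx> c"
  using add_mem[of "a - b" "b - c"] by (simp add: cong_def)

lemma cong_eq_trans [trans]: "a \<approx> b \<Longrightarrow> b = c \<Longrightarrow> a \<approx> c"
  and eq_cong_trans [trans]: "a = b \<Longrightarrow> b \<approx> c \<Longrightarrow> a \<approx> c"
  by simp_all

lemma cong_add: "a \<approx> b \<Longrightarrow> c \<approx> d \<Longrightarrow> a + c \<approx> b + d"
  using add_mem[of "a - b" "c - d"] by (simp add: cong_def algebra_simps)

lemma cong_mult: "a \<approx> b \<Longrightarrow> c \<approx> d \<Longrightarrow> a * c \<approx> b * d"
  using add_mem[of "(a - b) * c" "b * (c - d)"] left_mem[of "c - d" b] right_mem[of "a - b" c]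
  by (simp add: cong_def algebra_simps)

lemma cong_sandwich: "a \<approx> b \<Longrightarrow> c * a * d \<approx> c * b * d"
  by (intro cong_mult cong_refl)

lemma cong_sum: "(\<And>x. x \<in> X \<Longrightarrow> f x \<approx> g x) \<Longrightarrow> sum f X \<approx> sum g X"
  by (induction X rule: infinite_finite_induct) (auto intro: cong_add)

end


section \<open>The tensor square of the Leavitt algebra\<close>

abbreviation L12 :: "('k::field, (l12_gen list \<Rightarrow>\<^sub>0 'k) set) graded_star_algebra" where
  "L12 \<equiv> quotient_algebra free_l12 l12_ideal"

interpretation l12: star_ideal free_l12 l12_ideal
  by (rule star_ideal_l12)

lemma trivially_graded_simps [simp]:
  "carrier (trivially_graded A) = carrier A"
  "mult (trivially_graded A) = mult A"
  "add (trivially_graded A) = add A"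
  "zero (trivially_graded A) = zero A"
  "smult (trivially_graded A) = smult A"
  "star (trivially_graded A) = star A"
  "component (trivially_graded A) n = (if n = 0 then carrier A else {\<zero>\<^bsub>A\<^esub>})"
  by (simp_all add: trivially_graded_def)

lemma star_algebra_trivially_graded:
  assumes "star_algebra A"
  shows "star_algebra (trivially_graded A)"
proof -
  interpret star_algebra A by fact
  show ?thesis
  proof (intro star_algebra.intro star_algebra_axioms.intro)
    show "abelian_group (trivially_graded A)"
    proof (rule abelian_groupI)
      fix x assume "x \<in> carrier (trivially_graded A)"
      then show "\<exists>y\<in>carrier (trivially_graded A).
          y \<oplus>\<^bsub>trivially_graded A\<^esub> x = \<zero>\<^bsub>trivially_graded A\<^esub>"
        by (intro bexI[of _ "\<ominus>\<^bsub>A\<^esub> x"]) (auto simp: l_neg)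
    qed (auto simp: a_ac)
  qed (auto simp: mult_closed mult_add_left mult_add_right smult_closed smult_add
      smult_add_left smult_smult smult_one smult_mult_left smult_mult_right star_closed star_add
      star_smult)
qed

interpretation sq: star_algebra_pair L12 "trivially_graded L12"
  by (intro star_algebra_pair.intro l12.star_algebra_quotient star_algebra_trivially_graded)

definition l12_class :: "(l12_gen list \<Rightarrow>\<^sub>0 'k::field) \<Rightarrow> (l12_gen list \<Rightarrow>\<^sub>0 'k) set" where
  "l12_class p = l12_ideal +>\<^bsub>free_l12\<^esub> p"

lemma l12_class_simps:
  "l12_class p \<in> carrier L12"
  "l12_class p \<otimes>\<^bsub>L12\<^esub> l12_class q = l12_class (p * q)"
  "l12_class p \<oplus>\<^bsub>L12\<^esub> l12_class q = l12_class (p + q)"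
  "c \<odot>\<^bsub>L12\<^esub> l12_class p = l12_class (scale c p)"
  "star L12 (l12_class p) = l12_class (star free_l12 p)"
  "\<zero>\<^bsub>L12\<^esub> = l12_class 0"
  by (simp_all add: l12_class_def l12.quotient_simps)

lemma l12_class_surj: "a \<in> carrier L12 \<Longrightarrow> \<exists>p. a = l12_class p"
  by (auto simp: l12_class_def l12.quotient_simps)

lemma l12_class_eq_iff: "l12_class p = l12_class q \<longleftrightarrow> p - q \<in> l12_ideal"
proof -
  have "p \<ominus>\<^bsub>free_l12\<^esub> q = p - q"
    using l12.smult_minus_one[of q] by (simp add: a_minus_def scale_minus_one)
  then show ?thesis
    using l12.coset_eq_iff[of p q] by (simp add: l12_class_def)
qed

text \<open>
  Pairs of words form a monoid under concatenation in both components, and the functions on it are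
  the tensor square of the free algebra. It carries the computations, as its multiplication is
  that of a ring.
\<close>

type_synonym 'k free_square = "l12_gen list \<times> l12_gen list \<Rightarrow>\<^sub>0 'k"

lemma pair_mult [simp]:
  "(pair u v :: 'k::field free_square) * pair u' v' = pair (u @ u') (v @ v')"
  by (simp add: mult_single plus_prod_def plus_list_def)

lemma pair_Nil: "(pair [] [] :: 'k::field free_square) = 1"
  by (metis single_one zero_list_def zero_prod_def)

definition adj :: "l12_gen list \<Rightarrow> l12_gen list" where
  "adj w = rev (map l12_gen_star w)"

lemma adj_simps [simp]: "adj [] = []" "adj (g # w) = adj w @ [l12_gen_star g]"
  "adj (u @ v) = adj v @ adj u"
  by (simp_all add: adj_def)

lemma adj_adj [simp]: "adj (adj w) = w"
proof -
  have "l12_gen_star (l12_gen_star g) = g" for g by (cases g) auto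
  then show ?thesis by (induction w) (simp_all)
qed

definition square_star :: "'k::field free_square \<Rightarrow> 'k free_square" where
  "square_star = linear_extension (\<lambda>x. pair (adj (fst x)) (adj (snd x)))"

lemma square_star_pair [simp]: "square_star (pair u v) = pair (adj u) (adj v)"
  by (simp add: square_star_def)

lemma square_star_mult: "square_star (s * t) = square_star t * square_star s"
  unfolding square_star_def
  by (rule linear_extension_antimult) (simp add: plus_prod_def plus_list_def)

text \<open>
  The canonical map onto simple tensors of cosets, taken one level above the tensor product itself:
  its values are formal combinations of pairs of cosets. At this level it is an exact
  homomorphism, and only its composition with the quotient map is the projection onto the tensor square.
\<close>

definition to_square :: "'k::field free_square \<Rightarrow>
    (l12_gen list \<Rightarrow>\<^sub>0 'k) set \<times> (l12_gen list \<Rightarrow>\<^sub>0 'k) set \<Rightarrow>\<^sub>0 'k" where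
  "to_square = linear_extension (\<lambda>x. pair (l12_class (word (fst x))) (l12_class (word (snd x))))"

lemma to_square_pair [simp]:
  "to_square (pair u v) = pair (l12_class (word u)) (l12_class (word v))"
  by (simp add: to_square_def)

lemma to_square_linear:
  "to_square 0 = 0"
  "to_square (s + t) = to_square s + to_square t"
  "to_square (s - t) = to_square s - to_square t"
  "to_square (scale c s) = scale c (to_square s)"
  by (simp_all add: to_square_def linear_simps)

lemma free_square_induct [case_names zero add scale pair]:
  fixes s :: "'k::field free_square"
  assumes "Q 0" "\<And>p q. Q p \<Longrightarrow> Q q \<Longrightarrow> Q (p + q)" "\<And>c p. Q p \<Longrightarrow> Q (scale c p)"
    and "\<And>u v. Q (pair u v)"
  shows "Q s"
  using subset_UNIV by (induction s rule: span_induct_on) (use assms in auto)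

lemma to_square_carrier: "to_square s \<in> carrier sq.P"
  by (induction s rule: free_square_induct)
     (simp_all add: to_square_linear sq.carrier_closed sq.pair_carrier l12_class_simps)

lemma to_square_mult: "to_square (s * t) = to_square s \<otimes>\<^bsub>sq.P\<^esub> to_square t"
proof (induction s rule: free_square_induct)
  case (pair u v)
  show ?case
    by (induction t rule: free_square_induct)
       (simp_all add: to_square_linear sq.mult_linear sq.mult_pair distrib_left scale_mult_right
         l12_class_simps del: scale_single)
qed (simp_all add: to_square_linear sq.mult_linear distrib_right scale_mult_left)

lemma to_square_star: "to_square (square_star s) = star sq.P (to_square s)"
  unfolding sq.pair_algebra_simps
  by (induction s rule: free_square_induct)
     (simp_all add: to_square_linear square_star_def linear_simps l12_class_simps adj_def
       del: scale_single)

definition left_homogeneous :: "int \<Rightarrow> 'k::field free_square \<Rightarrow> bool" where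
  "left_homogeneous n s \<longleftrightarrow> (\<forall>x\<in>Poly_Mapping.keys s. sum_list (map l12_gen_deg (fst x)) = n)"

lemma left_homogeneous_pair [simp]:
  "left_homogeneous n (pair u v) \<longleftrightarrow> sum_list (map l12_gen_deg u) = n"
  by (simp add: left_homogeneous_def)

lemma left_homogeneous_add:
  "left_homogeneous n s \<Longrightarrow> left_homogeneous n t \<Longrightarrow> left_homogeneous n (s + t)"
  using Poly_Mapping.keys_add[of s t] unfolding left_homogeneous_def by blast

lemma left_homogeneous_mult:
  "left_homogeneous m s \<Longrightarrow> left_homogeneous n t \<Longrightarrow> left_homogeneous (m + n) (s * t)"
  using keys_mult[of s t] unfolding left_homogeneous_def by (fastforce simp: plus_list_def)

lemma to_square_component:
  assumes "left_homogeneous n s"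
  shows "to_square s \<in> component sq.P n"
proof -
  have "\<exists>i j. i + j = n \<and> fst y \<in> component L12 i \<and> snd y \<in> component (trivially_graded L12) j"
    if y: "y \<in> Poly_Mapping.keys (to_square s)" for y
  proof -
    obtain x where x: "x \<in> Poly_Mapping.keys s"
        "y = (l12_class (word (fst x)), l12_class (word (snd x)))"
      using y keys_linear_extension[of
          "\<lambda>x. pair (l12_class (word (fst x))) (l12_class (word (snd x)))" s]
      unfolding to_square_def by auto
    have "word (fst x) \<in> component free_l12 n"
      using assms x(1) by (simp add: left_homogeneous_def)
    then have "l12_class (word (fst x)) \<in> component L12 n"
      unfolding l12_class_def l12.component_quotient by (rule imageI)
    then show ?thesis
      using x(2) by (intro exI[of _ n] exI[of _ 0]) (simp add: l12_class_simps)
  qed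
  then show ?thesis
    by (simp add: sq.pair_algebra_simps)
qed

text \<open>
  The kernel of the projection of the free square onto the tensor square. Congruence modulo this
  ideal is equality in the tensor square of the Leavitt algebra.
\<close>

definition square_ideal :: "'k::field free_square set" where
  "square_ideal = {s. to_square s \<in> sq.bilin}"

interpretation sq: ring_ideal square_ideal
proof
  fix a b c :: "'k::field free_square"
  show "0 \<in> (square_ideal :: 'k free_square set)"
    by (simp add: square_ideal_def to_square_linear sq.bilin_closed)
  show "a - b \<in> square_ideal" if "a \<in> square_ideal" "b \<in> square_ideal"
    using that by (simp add: square_ideal_def to_square_linear sq.bilin_diff)
  show "c * a \<in> square_ideal" "a * c \<in> square_ideal" if "a \<in> square_ideal"
    using that sq.bilin_ideal to_square_carrier[of c]
    unfolding square_ideal_def mem_Collect_eq to_square_mult algebra_ideal_def by blast+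
qed

notation sq.cong (infix \<open>\<approx>\<close> 50)

text \<open>
  Up to the bilinearity relators, summing over words in one factor is the same as forming the
  class of the sum. This transfers the relations of the Leavitt algebra to either factor.
\<close>

lemma to_square_left:
  "to_square (linear_extension (\<lambda>u. pair u v) p) - pair (l12_class p) (l12_class (word v)) \<in> sq.bilin"
  using subset_UNIV
proof (induction p rule: span_induct_on)
  case zero
  show ?case
    using sq.bilin_diff[OF sq.bilin_closed(1) sq.bilin_relator[OF sq.bilinearity_relatorsI(3),
        of "l12_class 0" "l12_class (word v)" 0]]
    by (simp add: l12_class_simps to_square_linear)
next
  case (add p q)
  have "pair (l12_class p \<oplus>\<^bsub>L12\<^esub> l12_class q) (l12_class (word v))
      - pair (l12_class p) (l12_class (word v)) - pair (l12_class q) (l12_class (word v)) \<in> sq.bilin"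
    by (rule sq.bilin_relator[OF sq.bilinearity_relatorsI(1)]) (simp_all add: l12_class_simps)
  from sq.bilin_diff[OF sq.bilin_closed(2)[OF add] this] show ?case
    by (simp add: l12_class_simps to_square_linear linear_simps)
next
  case (scale c p)
  have "pair (c \<odot>\<^bsub>L12\<^esub> l12_class p) (l12_class (word v))
      - scale c (pair (l12_class p) (l12_class (word v))) \<in> sq.bilin"
    by (rule sq.bilin_relator[OF sq.bilinearity_relatorsI(3)]) (simp_all add: l12_class_simps)
  from sq.bilin_diff[OF sq.bilin_closed(3)[OF scale, of c] this] show ?case
    by (simp add: l12_class_simps to_square_linear linear_simps scale_diff)
qed (simp add: sq.bilin_closed)

lemma to_square_right:
  "to_square (linear_extension (\<lambda>v. pair u v) p) - pair (l12_class (word u)) (l12_class p) \<in> sq.bilin"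
  using subset_UNIV
proof (induction p rule: span_induct_on)
  case zero
  show ?case
    using sq.bilin_diff[OF sq.bilin_closed(1) sq.bilin_relator[OF sq.bilinearity_relatorsI(4),
        of "l12_class (word u)" "l12_class 0" 0]]
    by (simp add: l12_class_simps to_square_linear)
next
  case (add p q)
  have "pair (l12_class (word u)) (l12_class p \<oplus>\<^bsub>trivially_graded L12\<^esub> l12_class q)
      - pair (l12_class (word u)) (l12_class p) - pair (l12_class (word u)) (l12_class q) \<in> sq.bilin"
    by (rule sq.bilin_relator[OF sq.bilinearity_relatorsI(2)]) (simp_all add: l12_class_simps)
  from sq.bilin_diff[OF sq.bilin_closed(2)[OF add] this] show ?case
    by (simp add: l12_class_simps to_square_linear linear_simps)
next
  case (scale c p)
  have "pair (l12_class (word u)) (c \<odot>\<^bsub>trivially_graded L12\<^esub> l12_class p)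
      - scale c (pair (l12_class (word u)) (l12_class p)) \<in> sq.bilin"
    by (rule sq.bilin_relator[OF sq.bilinearity_relatorsI(4)]) (simp_all add: l12_class_simps)
  from sq.bilin_diff[OF sq.bilin_closed(3)[OF scale, of c] this] show ?case
    by (simp add: l12_class_simps to_square_linear linear_simps scale_diff)
qed (simp add: sq.bilin_closed)

lemma l12_class_relator: "p \<in> l12_relators \<Longrightarrow> l12_class p = l12_class 0"
  using l12.ideal_generated_superset[of l12_relators] by (auto simp: l12_class_eq_iff)

lemma left_relator:
  assumes "p \<in> l12_relators"
  shows "linear_extension (\<lambda>u. pair u []) p \<approx> 0"
  using sq.bilin_diff[OF to_square_left[of "[]" p] to_square_left[of "[]" 0]]
  unfolding sq.cong_zero_iff unfolding square_ideal_def
  by (simp add: l12_class_relator[OF assms] to_square_linear)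

lemma right_relator:
  assumes "p \<in> l12_relators"
  shows "linear_extension (\<lambda>v. pair [] v) p \<approx> 0"
  using sq.bilin_diff[OF to_square_right[of "[]" p] to_square_right[of "[]" 0]]
  unfolding sq.cong_zero_iff unfolding square_ideal_def
  by (simp add: l12_class_relator[OF assms] to_square_linear)

lemma l12_relators_eq:
  "l12_relators = {word [X1, X1s] + word [X2, X2s] - word [], word [X1s, X1] - word [],
     word [X2s, X2] - word [], word [X1s, X2], word [X2s, X1]}"
  by (simp add: l12_relators_def gen_def word_Nil)

lemma left_relations:
  "pair [X1, X1s] [] + pair [X2, X2s] [] \<approx> 1"
  "pair [X1s, X1] [] \<approx> 1" "pair [X2s, X2] [] \<approx> 1"
  "pair [X1s, X2] [] \<approx> 0" "pair [X2s, X1] [] \<approx> 0"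
  using left_relator[unfolded l12_relators_eq]
  by (force simp: sq.cong_def linear_simps simp flip: pair_Nil)+

lemma right_relations:
  "pair [] [X1, X1s] + pair [] [X2, X2s] \<approx> 1"
  "pair [] [X1s, X1] \<approx> 1" "pair [] [X2s, X2] \<approx> 1"
  "pair [] [X1s, X2] \<approx> 0" "pair [] [X2s, X1] \<approx> 0"
  using right_relator[unfolded l12_relators_eq]
  by (force simp: sq.cong_def linear_simps simp flip: pair_Nil)+


section \<open>A linear form on the tensor square\<close>

text \<open>
  The generators act as partial injections of \<open>\<int> \<times> \<nat>\<close>: \<open>x\<^sub>1\<close> and \<open>x\<^sub>2\<close> identify \<open>\<nat>\<close> with the even and the odd
  numbers, their adjoints invert them, and the integer counts the degree. The linearisation is a
  representation of the Leavitt algebra, of which \<open>base_coeff\<close> below is the diagonal matrix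
  coefficient at \<open>(0, 0)\<close>. The integer makes this coefficient vanish in nonzero degree.
\<close>

fun gen_act :: "l12_gen \<Rightarrow> int \<times> nat \<Rightarrow> (int \<times> nat) option" where
  "gen_act X1 (k, n) = Some (k + 1, 2 * n)"
| "gen_act X2 (k, n) = Some (k + 1, 2 * n + 1)"
| "gen_act X1s (k, n) = (if even n then Some (k - 1, n div 2) else None)"
| "gen_act X2s (k, n) = (if odd n then Some (k - 1, n div 2) else None)"

fun word_act :: "l12_gen list \<Rightarrow> int \<times> nat \<Rightarrow> (int \<times> nat) option" where
  "word_act [] s = Some s"
| "word_act (g # w) s = Option.bind (word_act w s) (gen_act g)"

lemma word_act_append: "word_act (u @ v) s = Option.bind (word_act v s) (word_act u)"
  by (induction u) (auto split: Option.bind_split)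

lemma word_act_deg: "word_act w s = Some s' \<Longrightarrow> fst s' = fst s + sum_list (map l12_gen_deg w)"
proof (induction w arbitrary: s')
  case (Cons g w)
  then obtain k n where "word_act w s = Some (k, n)" "gen_act g (k, n) = Some s'"
    by (auto split: Option.bind_splits)
  then show ?case
    using Cons.IH[of "(k, n)"] by (cases g) (auto split: if_splits)
qed simp

definition base_coeff :: "l12_gen list \<Rightarrow> 'k::field" where
  "base_coeff w = (if word_act w (0, 0) = Some (0, 0) then 1 else 0)"

lemma base_coeff_deg: "sum_list (map l12_gen_deg w) \<noteq> 0 \<Longrightarrow> base_coeff w = 0"
  using word_act_deg[of w "(0, 0)" "(0, 0)"] by (auto simp: base_coeff_def)

lemma word_act_relations:
  "word_act [X1, X1s] s = (if even (snd s) then Some s else None)"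
  "word_act [X2, X2s] s = (if even (snd s) then None else Some s)"
  "word_act [X1s, X1] s = Some s" "word_act [X2s, X2] s = Some s"
  "word_act [X1s, X2] s = None" "word_act [X2s, X1] s = None"
  by (cases s; auto)+

lemma base_coeff_relator:
  assumes "p \<in> l12_relators"
  shows "linear_form base_coeff (word u * p * word v) = (0 :: 'k::field)"
proof -
  have coeff: "base_coeff (u @ r @ v) = (case word_act v (0, 0) of None \<Rightarrow> 0
      | Some s \<Rightarrow> if Option.bind (word_act r s) (word_act u) = Some (0, 0) then 1 else (0 :: 'k))" for r
    by (simp add: base_coeff_def word_act_append split: option.split)
  note word_act.simps(2) [simp del]
  have "p = word [X1, X1s] + word [X2, X2s] - word [] \<or> p = word [X1s, X1] - word [] \<or>
      p = word [X2s, X2] - word [] \<or> p = word [X1s, X2] \<or> p = word [X2s, X1]"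
    using assms unfolding l12_relators_eq by blast
  then show ?thesis
    by (elim disjE; hypsubst; unfold distrib_left distrib_right left_diff_distrib
        right_diff_distrib word_mult append_assoc linear_form_add linear_form_diff
        linear_form_single coeff; simp add: word_act_relations split: option.split)
qed

lemma base_coeff_l12_ideal:
  assumes "p \<in> l12_ideal"
  shows "linear_form base_coeff p = (0 :: 'k::field)"
proof -
  \<comment> \<open>The condition with \<open>u\<close> and \<open>v\<close> on the two sides defines an ideal, unlike the vanishing of the form alone.\<close>
  let ?U = "{p :: l12_gen list \<Rightarrow>\<^sub>0 'k. \<forall>u v. linear_form base_coeff (word u * p * word v) = (0 :: 'k)}"
  have mult: "linear_form base_coeff (word u * (a * x) * word v) = 0"
      "linear_form base_coeff (word u * (x * a) * word v) = 0"
    if x: "x \<in> ?U" for a x :: "l12_gen list \<Rightarrow>\<^sub>0 'k" and u v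
  proof -
    show "linear_form base_coeff (word u * (a * x) * word v) = 0"
      using subset_UNIV
    proof (induction a rule: span_induct_on)
      case (single w)
      have "word u * (word w * x) * word v = word (u @ w) * x * word v"
        by (simp add: mult.assoc flip: word_mult)
      then show ?case using x by simp
    qed (simp_all add: linear_simps distrib_left distrib_right scale_mult_left scale_mult_right)
    show "linear_form base_coeff (word u * (x * a) * word v) = 0"
      using subset_UNIV
    proof (induction a rule: span_induct_on)
      case (single w)
      have "word u * (x * word w) * word v = word u * x * word (w @ v)"
        by (simp add: mult.assoc flip: word_mult)
      then show ?case using x by simp
    qed (simp_all add: linear_simps distrib_left distrib_right scale_mult_left scale_mult_right)
  qed
  have "algebra_ideal free_l12 ?U"
    unfolding algebra_ideal_def l12.linear_subspace_iff using mult
    by (simp add: linear_simps distrib_left distrib_right scale_mult_left scale_mult_right)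
  then have "l12_ideal \<subseteq> ?U"
    using base_coeff_relator by (intro l12.ideal_generated_minimal) auto
  then have "linear_form base_coeff (word [] * p * word []) = 0"
    using assms by blast
  then show ?thesis
    by (simp add: word_Nil)
qed

definition square_form :: "'k::field free_square \<Rightarrow> 'k" where
  "square_form = linear_form (\<lambda>x. base_coeff (fst x) * base_coeff (snd x))"

text \<open>
  The matrix coefficient is constant on cosets of the ideal of the Leavitt algebra, and a product of
  two such linear forms descends to the tensor product.
\<close>

lemma square_form_square_ideal:
  assumes s: "s \<in> square_ideal"
  shows "square_form s = (0 :: 'k::field)"
proof -
  \<comment> \<open>The form that the matrix coefficient induces on cosets.\<close>
  define F :: "(l12_gen list \<Rightarrow>\<^sub>0 'k) set \<Rightarrow> 'k" where
    "F X = linear_form base_coeff (SOME p. l12_class p = X)" for X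
  have F: "F (l12_class p) = linear_form base_coeff p" for p
  proof -
    have "l12_class (SOME q. l12_class q = l12_class p) = l12_class p"
      by (rule someI) (rule refl)
    then show ?thesis
      using base_coeff_l12_ideal
      by (fastforce simp: F_def l12_class_eq_iff linear_simps)
  qed
  have "linear_form (\<lambda>y. F (fst y) * F (snd y)) (to_square s) = square_form s"
    by (induction s rule: free_square_induct)
       (simp_all add: square_form_def to_square_linear linear_simps F del: scale_single)
  moreover have "linear_form (\<lambda>y. F (fst y) * F (snd y)) (to_square s) = 0"
  proof (rule sq.linear_form_bilin)
    show "to_square s \<in> sq.bilin"
      using s by (simp add: square_ideal_def)
  qed (auto dest!: l12_class_surj simp: l12_class_simps F linear_simps)
  ultimately show ?thesis by simp
qed

lemma square_form_cong: "s \<approx> t \<Longrightarrow> square_form s = square_form t"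
  using square_form_square_ideal[of "s - t"] by (simp add: sq.cong_def square_form_def linear_simps)

lemma square_form_one: "square_form (1 :: 'k::field free_square) = 1"
  unfolding pair_Nil[symmetric] by (simp add: square_form_def base_coeff_def)

lemma square_form_deg:
  assumes "left_homogeneous n s" "n \<noteq> 0"
  shows "square_form s = 0"
  unfolding square_form_def linear_form_def using assms
  by (intro sum.neutral ballI) (simp add: left_homogeneous_def base_coeff_deg)


section \<open>A Cuntz--Krieger family in the tensor square\<close>

lemma right_rewrite:
  assumes "(pair [] r :: 'k::field free_square) \<approx> s"
  shows "pair [] (u @ r @ v) \<approx> pair [] u * s * pair [] v"
  using sq.cong_sandwich[OF assms, of "pair [] u" "pair [] v"] by simp

lemma right_isometry:
  "pair [] (u @ [X1s, X1] @ v) \<approx> pair [] (u @ v)"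
  "pair [] (u @ [X2s, X2] @ v) \<approx> pair [] (u @ v)"
  "pair [] (u @ [X1s, X2] @ v) \<approx> 0"
  "pair [] (u @ [X2s, X1] @ v) \<approx> 0"
  using right_relations(2-)[THEN right_rewrite, of u v] by simp_all

text \<open>
  A finite nonempty set is coded by positive words in \<open>x\<^sub>1, x\<^sub>2\<close> whose ranges partition the unit: a
  new element gets the word \<open>x\<^sub>1\<close>, and all earlier words move below \<open>x\<^sub>2\<close>.
\<close>

lemma complete_prefix_code:
  assumes "finite X" "X \<noteq> {}"
  shows "\<exists>t. (\<forall>e\<in>X. \<forall>f\<in>X. (pair [] (adj (t e) @ t f) :: 'k::field free_square) \<approx> (if e = f then 1 else 0))
    \<and> (\<Sum>e\<in>X. pair [] (t e @ adj (t e)) :: 'k free_square) \<approx> 1"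
  using assms
proof (induction rule: finite_ne_induct)
  case (singleton e)
  show ?case
    by (rule exI[of _ "\<lambda>_. []"]) (simp add: pair_Nil)
next
  case (insert e X)
  then obtain t where orth: "\<And>f g. f \<in> X \<Longrightarrow> g \<in> X \<Longrightarrow>
        (pair [] (adj (t f) @ t g) :: 'k free_square) \<approx> (if f = g then 1 else 0)"
      and sum: "(\<Sum>f\<in>X. pair [] (t f @ adj (t f)) :: 'k free_square) \<approx> 1"
    by blast
  define t' where "t' f = (if f = e then [X1] else X2 # t f)" for f
  have "(pair [] (adj (t' f) @ t' g) :: 'k free_square) \<approx> (if f = g then 1 else 0)"
    if "f \<in> insert e X" "g \<in> insert e X" for f g
  proof -
    consider "f = e" "g = e" | "f = e" "g \<noteq> e" "g \<in> X" | "f \<noteq> e" "f \<in> X" "g = e"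
      | "f \<noteq> e" "f \<in> X" "g \<noteq> e" "g \<in> X"
      using \<open>f \<in> insert e X\<close> \<open>g \<in> insert e X\<close> by blast
    then show ?thesis
    proof cases
      case 1
      then show ?thesis using right_isometry(1)[of "[]" "[]"] by (simp add: t'_def pair_Nil)
    next
      case 2
      then show ?thesis using right_isometry(3)[of "[]" "t g"] by (auto simp: t'_def)
    next
      case 3
      then show ?thesis using right_isometry(4)[of "adj (t f)" "[]"] by (auto simp: t'_def)
    next
      case 4
      then show ?thesis
        using sq.cong_trans[OF right_isometry(2)[of "adj (t f)" "t g"] orth] by (auto simp: t'_def)
    qed
  qed
  moreover have "(\<Sum>f\<in>insert e X. pair [] (t' f @ adj (t' f)) :: 'k free_square) \<approx> 1"
  proof -
    have "(\<Sum>f\<in>X. pair [] (t' f @ adj (t' f)) :: 'k free_square)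
        = (\<Sum>f\<in>X. pair [] [X2] * pair [] (t f @ adj (t f)) * pair [] [X2s])"
      using insert.hyps by (intro sum.cong) (auto simp: t'_def)
    also have "\<dots> = pair [] [X2] * (\<Sum>f\<in>X. pair [] (t f @ adj (t f))) * pair [] [X2s]"
      by (simp only: sum_distrib_left sum_distrib_right)
    also have "\<dots> \<approx> pair [] [X2] * 1 * pair [] [X2s]"
      using sum by (rule sq.cong_sandwich)
    finally have "(\<Sum>f\<in>X. pair [] (t' f @ adj (t' f)) :: 'k free_square) \<approx> pair [] [X2, X2s]"
      by simp
    then have "pair [] [X1, X1s] + (\<Sum>f\<in>X. pair [] (t' f @ adj (t' f)) :: 'k free_square)
        \<approx> pair [] [X1, X1s] + pair [] [X2, X2s]"
      by (intro sq.cong_add sq.cong_refl)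
    also have "\<dots> \<approx> 1"
      by (rule right_relations)
    finally show ?thesis
      using insert.hyps by (simp add: t'_def)
  qed
  ultimately show ?case by blast
qed

lemma orthogonal_isometries:
  "(pair [] (adj (replicate m X2 @ [X1]) @ replicate n X2 @ [X1]) :: 'k::field free_square)
     \<approx> (if m = n then 1 else 0)"
proof (induction m arbitrary: n)
  case 0
  show ?case
    using right_isometry(1)[of "[]" "[]"] right_isometry(3)[of "[]" "replicate (n - 1) X2 @ [X1]"]
    by (cases n) (simp_all add: pair_Nil)
next
  case (Suc m)
  show ?case
  proof (cases n)
    case 0
    then show ?thesis
      using right_isometry(4)[of "adj (replicate m X2 @ [X1])" "[]"] by simp
  next
    case (Suc n')
    then show ?thesis
      using sq.cong_trans[OF right_isometry(2)[of "adj (replicate m X2 @ [X1])"] Suc.IH[of n']]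
      by simp
  qed
qed

text \<open>
  The unitary of degree 1. In \<open>shift * shift_adj\<close> the mixed terms vanish by the relations in the
  second factor, and the remaining ones add up to 1 by the relation in the first factor; in
  \<open>shift_adj * shift\<close> the factors exchange roles.
\<close>

definition shift :: "'k::field free_square" where
  "shift = pair [X1] [X1s] + pair [X2] [X2s]"

definition shift_adj :: "'k::field free_square" where
  "shift_adj = pair [X1s] [X1] + pair [X2s] [X2]"

lemma shift_unitary:
  "(shift :: 'k::field free_square) * shift_adj \<approx> 1"
  "(shift_adj :: 'k::field free_square) * shift \<approx> 1"
proof -
  have split: "pair u v = (pair u [] :: 'k free_square) * pair [] v" for u v
    by simp
  have "(shift :: 'k free_square) * shift_adj
      = (pair [X1, X1s] [] * pair [] [X1s, X1] + pair [X1, X2s] [] * pair [] [X1s, X2])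
        + (pair [X2, X1s] [] * pair [] [X2s, X1] + pair [X2, X2s] [] * pair [] [X2s, X2])"
    by (simp add: shift_def shift_adj_def distrib_left distrib_right add_ac)
  also have "\<dots> \<approx> (pair [X1, X1s] [] * 1 + pair [X1, X2s] [] * 0)
        + (pair [X2, X1s] [] * 0 + pair [X2, X2s] [] * 1)"
    by (intro sq.cong_add sq.cong_mult sq.cong_refl right_relations)
  also have "\<dots> = pair [X1, X1s] [] + pair [X2, X2s] []"
    by simp
  also have "\<dots> \<approx> 1"
    by (rule left_relations)
  finally show "(shift :: 'k free_square) * shift_adj \<approx> 1" .
  have "(shift_adj :: 'k free_square) * shift
      = (pair [X1s, X1] [] * pair [] [X1, X1s] + pair [X1s, X2] [] * pair [] [X1, X2s])
        + (pair [X2s, X1] [] * pair [] [X2, X1s] + pair [X2s, X2] [] * pair [] [X2, X2s])"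
    by (simp add: shift_def shift_adj_def distrib_left distrib_right add_ac)
  also have "\<dots> \<approx> (1 * pair [] [X1, X1s] + 0 * pair [] [X1, X2s])
        + (0 * pair [] [X2, X1s] + 1 * pair [] [X2, X2s])"
    by (intro sq.cong_add sq.cong_mult sq.cong_refl left_relations)
  also have "\<dots> = pair [] [X1, X1s] + pair [] [X2, X2s]"
    by simp
  also have "\<dots> \<approx> 1"
    by (rule right_relations)
  finally show "(shift_adj :: 'k free_square) * shift \<approx> 1" .
qed

text \<open>
  The words \<open>y v\<close> and \<open>t e\<close> are placed in the second tensor factor. The parameter \<open>K\<close> fixes the field,
  which no other parameter mentions.
\<close>

locale leavitt_family = wf_digraph E for E :: "('v, 'e) pre_digraph" +
  fixes K :: "'k::field itself"
    and y :: "'v \<Rightarrow> l12_gen list"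
    and t :: "'e \<Rightarrow> l12_gen list"
  assumes vertex_orth: "v \<in> verts E \<Longrightarrow> w \<in> verts E \<Longrightarrow>
      (pair [] (adj (y v) @ y w) :: 'k free_square) \<approx> (if v = w then 1 else 0)"
    and edge_orth: "e \<in> arcs E \<Longrightarrow> f \<in> arcs E \<Longrightarrow> tail E e = tail E f \<Longrightarrow>
      (pair [] (adj (t e) @ t f) :: 'k free_square) \<approx> (if e = f then 1 else 0)"
    and edge_sum: "regular_vertex E v \<Longrightarrow>
      (\<Sum>e\<in>out_arcs E v. pair [] (t e @ adj (t e)) :: 'k free_square) \<approx> 1"
begin

fun gen_image :: "('v, 'e) lpa_gen \<Rightarrow> 'k free_square" where
  "gen_image (Vertex v) = pair [] (y v) * pair [] (adj (y v))"
| "gen_image (Edge e) =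
     pair [] (y (tail E e)) * shift * (pair [] (t e) * pair [] (adj (y (head E e))))"
| "gen_image (Ghost e) =
     pair [] (y (head E e)) * pair [] (adj (t e)) * shift_adj * pair [] (adj (y (tail E e)))"

definition family_map :: "(('v, 'e) lpa_gen list \<Rightarrow>\<^sub>0 'k) \<Rightarrow> 'k free_square" where
  "family_map = linear_extension (\<lambda>w. prod_list (map gen_image w))"

lemma family_map_linear:
  "family_map 0 = 0"
  "family_map (p + q) = family_map p + family_map q"
  "family_map (p - q) = family_map p - family_map q"
  "family_map (scale c p) = scale c (family_map p)"
  "family_map (sum f X) = (\<Sum>x\<in>X. family_map (f x))"
  by (simp_all add: family_map_def linear_simps)

lemma family_map_word: "family_map (word w) = prod_list (map gen_image w)"
  by (simp add: family_map_def)

lemma family_map_mult: "family_map (p * q) = family_map p * family_map q"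
  unfolding family_map_def by (rule linear_extension_mult[of UNIV]) (simp_all add: plus_list_def)

lemma family_map_star: "square_star (family_map p) = family_map (star (free_lpa E) p)"
proof -
  have shift: "square_star shift = (shift_adj :: 'k free_square)"
      "square_star shift_adj = (shift :: 'k free_square)"
    by (simp_all add: shift_def shift_adj_def square_star_def linear_simps adj_def)
  have gen: "square_star (gen_image g) = gen_image (lpa_gen_star g)" for g
    by (cases g) (simp_all add: square_star_mult shift mult.assoc del: pair_mult)
  have word: "square_star (prod_list (map gen_image w))
      = prod_list (map gen_image (rev (map lpa_gen_star w)))" for w
  proof (induction w)
    case Nil
    show ?case unfolding pair_Nil[symmetric] by (simp flip: pair_Nil)
  qed (simp add: square_star_mult gen)
  have linear: "square_star 0 = (0 :: 'k free_square)"
      "square_star (a + b) = square_star a + square_star b"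
      "square_star (scale c a) = scale c (square_star a)" for a b :: "'k free_square" and c
    by (simp_all add: square_star_def linear_simps)
  show ?thesis
    using subset_UNIV
    by (induction p rule: span_induct_on)
       (simp_all add: family_map_def linear linear_simps word del: scale_single)
qed

lemma gen_image_homogeneous: "left_homogeneous (lpa_gen_deg g) (gen_image g)"
proof -
  have shift: "left_homogeneous 1 (shift :: 'k free_square)"
      "left_homogeneous (- 1) (shift_adj :: 'k free_square)"
    by (simp_all add: shift_def shift_adj_def left_homogeneous_add)
  have right: "left_homogeneous 0 (pair [] w :: 'k free_square)" for w
    by simp
  show ?thesis
    using left_homogeneous_mult[OF left_homogeneous_mult[OF right shift(1)] right]
      left_homogeneous_mult[OF left_homogeneous_mult[OF right shift(2)] right]
    by (cases g) simp_all
qed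

lemma family_map_word_homogeneous: "left_homogeneous (sum_list (map lpa_gen_deg w)) (family_map (word w))"
  unfolding family_map_word
proof (induction w)
  case Nil
  show ?case by (simp flip: pair_Nil)
qed (simp add: left_homogeneous_mult gen_image_homogeneous)

text \<open>
  Each product of two images has two words meeting in the middle which cancel by orthogonality of
  the \<open>y v\<close>. The last two relations then use that \<open>shift\<close> is unitary, together with
  the orthogonality of the \<open>t e\<close>, respectively with the decomposition of the unit into their ranges.
\<close>

lemma family_map_relator:
  assumes "p \<in> lpa_relators E"
  shows "family_map p \<approx> 0"
proof -
  let ?r = "\<lambda>w. pair [] w :: 'k free_square"
  have yy: "?r (adj (y v)) * ?r (y w) \<approx> (if v = w then 1 else 0)"
    if "v \<in> verts E" "w \<in> verts E" for v w
    using vertex_orth[OF that] by simp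
  have yy1: "?r (adj (y v)) * ?r (y v) \<approx> 1" if "v \<in> verts E" for v
    using vertex_orth[OF that that] by simp
  note [simp del] = pair_mult
  note [simp] = family_map_linear family_map_word
  have diffI: "a \<approx> b \<Longrightarrow> a - b \<approx> 0" for a b :: "'k free_square"
    by (simp add: sq.cong_def)
  have ends: "tail E e \<in> verts E" "head E e \<in> verts E" if "e \<in> arcs E" for e
    using that by simp_all
  from assms show ?thesis
  proof (cases rule: lpa_relators_cases)
    case (vertices v w)
    have "gen_image (Vertex v) * gen_image (Vertex w)
        = ?r (y v) * (?r (adj (y v)) * ?r (y w)) * ?r (adj (y w))"
      by (simp add: mult.assoc)
    also have "\<dots> \<approx> ?r (y v) * (if v = w then 1 else 0) * ?r (adj (y w))"
      by (rule sq.cong_sandwich[OF yy[OF vertices(1,2)]])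
    finally show ?thesis
      using vertices by (auto intro: diffI)
  next
    case (tail_edge e)
    have "gen_image (Vertex (tail E e)) * gen_image (Edge e)
        = ?r (y (tail E e)) * (?r (adj (y (tail E e))) * ?r (y (tail E e)))
          * (shift * (?r (t e) * ?r (adj (y (head E e)))))"
      by (simp add: mult.assoc)
    also have "\<dots> \<approx> ?r (y (tail E e)) * 1 * (shift * (?r (t e) * ?r (adj (y (head E e)))))"
      by (rule sq.cong_sandwich[OF yy1[OF ends(1)[OF tail_edge(1)]]])
    finally show ?thesis
      using tail_edge by (auto intro!: diffI simp: mult.assoc)
  next
    case (edge_head e)
    have "gen_image (Edge e) * gen_image (Vertex (head E e))
        = (?r (y (tail E e)) * shift * ?r (t e)) * (?r (adj (y (head E e))) * ?r (y (head E e)))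
          * ?r (adj (y (head E e)))"
      by (simp add: mult.assoc)
    also have "\<dots> \<approx> (?r (y (tail E e)) * shift * ?r (t e)) * 1 * ?r (adj (y (head E e)))"
      by (rule sq.cong_sandwich[OF yy1[OF ends(2)[OF edge_head(1)]]])
    finally show ?thesis
      using edge_head by (auto intro!: diffI simp: mult.assoc)
  next
    case (head_ghost e)
    have "gen_image (Vertex (head E e)) * gen_image (Ghost e)
        = ?r (y (head E e)) * (?r (adj (y (head E e))) * ?r (y (head E e)))
          * (?r (adj (t e)) * shift_adj * ?r (adj (y (tail E e))))"
      by (simp add: mult.assoc)
    also have "\<dots> \<approx> ?r (y (head E e)) * 1 * (?r (adj (t e)) * shift_adj * ?r (adj (y (tail E e))))"
      by (rule sq.cong_sandwich[OF yy1[OF ends(2)[OF head_ghost(1)]]])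
    finally show ?thesis
      using head_ghost by (auto intro!: diffI simp: mult.assoc)
  next
    case (ghost_tail e)
    have "gen_image (Ghost e) * gen_image (Vertex (tail E e))
        = (?r (y (head E e)) * ?r (adj (t e)) * shift_adj)
          * (?r (adj (y (tail E e))) * ?r (y (tail E e))) * ?r (adj (y (tail E e)))"
      by (simp add: mult.assoc)
    also have "\<dots> \<approx> (?r (y (head E e)) * ?r (adj (t e)) * shift_adj) * 1 * ?r (adj (y (tail E e)))"
      by (rule sq.cong_sandwich[OF yy1[OF ends(1)[OF ghost_tail(1)]]])
    finally show ?thesis
      using ghost_tail by (auto intro!: diffI simp: mult.assoc)
  next
    case (ghost_edge e f)
    let ?a = "?r (y (head E e)) * ?r (adj (t e)) * shift_adj"
    let ?b = "shift * (?r (t f) * ?r (adj (y (head E f))))"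
    have "gen_image (Ghost e) * gen_image (Edge f)
        = ?a * (?r (adj (y (tail E e))) * ?r (y (tail E f))) * ?b"
      by (simp add: mult.assoc)
    also have "\<dots> \<approx> ?a * (if tail E e = tail E f then 1 else 0) * ?b"
      by (rule sq.cong_sandwich[OF yy[OF ends(1)[OF ghost_edge(1)] ends(1)[OF ghost_edge(2)]]])
    finally have *: "gen_image (Ghost e) * gen_image (Edge f)
        \<approx> ?a * (if tail E e = tail E f then 1 else 0) * ?b" .
    show ?thesis
    proof (cases "tail E e = tail E f")
      case True
      note *
      also have "?a * (if tail E e = tail E f then 1 else 0) * ?b
          = (?r (y (head E e)) * ?r (adj (t e))) * (shift_adj * shift)
            * (?r (t f) * ?r (adj (y (head E f))))"
        using True by (simp add: mult.assoc)
      also have "\<dots> \<approx> (?r (y (head E e)) * ?r (adj (t e))) * 1 * (?r (t f) * ?r (adj (y (head E f))))"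
        by (rule sq.cong_sandwich[OF shift_unitary(2)])
      also have "\<dots> = ?r (y (head E e)) * (?r (adj (t e)) * ?r (t f)) * ?r (adj (y (head E f)))"
        by (simp add: mult.assoc)
      also have "\<dots> \<approx> ?r (y (head E e)) * (if e = f then 1 else 0) * ?r (adj (y (head E f)))"
        using edge_orth[OF ghost_edge(1,2) True] by (intro sq.cong_sandwich) (simp add: pair_mult)
      finally show ?thesis
        using ghost_edge by (auto intro: diffI)
    next
      case False
      then show ?thesis
        using * ghost_edge by auto
    qed
  next
    case (cuntz_krieger v)
    have fin: "e \<in> arcs E" "tail E e = v" if "e \<in> out_arcs E v" for e
      using that by auto
    have "(\<Sum>e\<in>out_arcs E v. gen_image (Edge e) * gen_image (Ghost e))
        = (\<Sum>e\<in>out_arcs E v. (?r (y v) * shift * ?r (t e))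
            * (?r (adj (y (head E e))) * ?r (y (head E e))) * (?r (adj (t e)) * shift_adj * ?r (adj (y v))))"
      by (intro sum.cong) (simp_all add: mult.assoc)
    also have "\<dots> \<approx> (\<Sum>e\<in>out_arcs E v. (?r (y v) * shift * ?r (t e))
            * 1 * (?r (adj (t e)) * shift_adj * ?r (adj (y v))))"
      by (intro sq.cong_sum sq.cong_sandwich yy1 ends fin)
    also have "\<dots> = (\<Sum>e\<in>out_arcs E v. (?r (y v) * shift) * ?r (t e @ adj (t e))
            * (shift_adj * ?r (adj (y v))))"
    proof (intro sum.cong refl)
      fix e
      have "?r (t e @ adj (t e)) = ?r (t e) * ?r (adj (t e))"
        by (simp add: pair_mult)
      then show "(?r (y v) * shift * ?r (t e)) * 1 * (?r (adj (t e)) * shift_adj * ?r (adj (y v)))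
          = (?r (y v) * shift) * ?r (t e @ adj (t e)) * (shift_adj * ?r (adj (y v)))"
        by (simp add: mult.assoc)
    qed
    also have "\<dots> = (?r (y v) * shift) * (\<Sum>e\<in>out_arcs E v. ?r (t e @ adj (t e)))
            * (shift_adj * ?r (adj (y v)))"
      by (simp only: sum_distrib_left sum_distrib_right)
    also have "\<dots> \<approx> (?r (y v) * shift) * 1 * (shift_adj * ?r (adj (y v)))"
      by (rule sq.cong_sandwich[OF edge_sum[OF cuntz_krieger(1)]])
    also have "\<dots> = ?r (y v) * (shift * shift_adj) * ?r (adj (y v))"
      by (simp add: mult.assoc)
    also have "\<dots> \<approx> ?r (y v) * 1 * ?r (adj (y v))"
      by (rule sq.cong_sandwich[OF shift_unitary(1)])
    finally have "(\<Sum>e\<in>out_arcs E v. gen_image (Edge e) * gen_image (Ghost e)) \<approx> gen_image (Vertex v)"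
      by simp
    then show ?thesis
      using diffI[OF sq.cong_sym] cuntz_krieger by simp
  qed
qed

end

lemma leavitt_family_exists:
  fixes E :: "('v, 'e) pre_digraph"
  assumes "wf_digraph E" "countable (verts E)" "row_finite E"
  shows "\<exists>y t. leavitt_family TYPE('k::field) E y t"
proof -
  interpret wf_digraph E by fact
  let ?code = "\<lambda>X t. (\<forall>e\<in>X. \<forall>f\<in>X.
      (pair [] (adj (t e) @ t f) :: 'k free_square) \<approx> (if e = f then 1 else 0))
    \<and> (\<Sum>e\<in>X. pair [] (t e @ adj (t e)) :: 'k free_square) \<approx> 1"
  define t where "t v = (SOME t. ?code (out_arcs E v) t)" for v
  have t: "?code (out_arcs E v) (t v)" if "v \<in> verts E" "out_arcs E v \<noteq> {}" for v
  proof -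
    have "finite (out_arcs E v)"
      using that assms(3) by (simp add: row_finite_def)
    then have "\<exists>t. ?code (out_arcs E v) t"
      using that(2) by (rule complete_prefix_code)
    then show ?thesis
      unfolding t_def by (rule someI_ex)
  qed
  define y where "y v = replicate (to_nat_on (verts E) v) X2 @ [X1]" for v
  have "leavitt_family TYPE('k) E y (\<lambda>e. t (tail E e) e)"
  proof
    fix v w assume "v \<in> verts E" "w \<in> verts E"
    then show "(pair [] (adj (y v) @ y w) :: 'k free_square) \<approx> (if v = w then 1 else 0)"
      using orthogonal_isometries[of "to_nat_on (verts E) v" "to_nat_on (verts E) w"]
      unfolding y_def by (simp only: to_nat_on_inj[OF assms(2)])
  next
    fix e f assume ef: "e \<in> arcs E" "f \<in> arcs E" "tail E e = tail E f"
    then have "e \<in> out_arcs E (tail E f)" "f \<in> out_arcs E (tail E f)"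
      by simp_all
    moreover have "?code (out_arcs E (tail E f)) (t (tail E f))"
      using ef by (intro t) auto
    ultimately show "(pair [] (adj (t (tail E e) e) @ t (tail E f) f) :: 'k free_square)
        \<approx> (if e = f then 1 else 0)"
      using ef(3) by simp
  next
    fix v assume v: "regular_vertex E v"
    then have "(\<Sum>e\<in>out_arcs E v. pair [] (t v e @ adj (t v e)) :: 'k free_square) \<approx> 1"
      using t[of v] by (auto simp: regular_vertex_def)
    moreover have "(\<Sum>e\<in>out_arcs E v. pair [] (t (tail E e) e @ adj (t (tail E e) e)) :: 'k free_square)
        = (\<Sum>e\<in>out_arcs E v. pair [] (t v e @ adj (t v e)))"
      by (intro sum.cong) auto
    ultimately show "(\<Sum>e\<in>out_arcs E v. pair [] (t (tail E e) e @ adj (t (tail E e) e)) :: 'k free_square) \<approx> 1"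
      by simp
  qed
  then show ?thesis by blast
qed


section \<open>Monomials in Leavitt path algebras and graded uniqueness\<close>

text \<open>
  Congruence modulo the defining ideal, that is, equality in the Leavitt path algebra of elements of
  the free algebra.
\<close>

definition lpa_cong ::
    "('v, 'e) pre_digraph \<Rightarrow> (('v, 'e) lpa_gen list \<Rightarrow>\<^sub>0 'k::field) \<Rightarrow> _ \<Rightarrow> bool" where
  "lpa_cong E x y \<longleftrightarrow> x - y \<in> lpa_ideal E"

locale row_finite_digraph = wf_digraph E for E :: "('v, 'e) pre_digraph" +
  assumes row_finite: "row_finite E"
begin

abbreviation cong (infix \<open>\<sim>\<close> 50) where "x \<sim> y \<equiv> lpa_cong E x y"

lemma lpa_ideal_mem:
  fixes x y :: "('v, 'e) lpa_gen list \<Rightarrow>\<^sub>0 'k::field"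
  shows "(0 :: ('v, 'e) lpa_gen list \<Rightarrow>\<^sub>0 'k) \<in> lpa_ideal E"
    and "x \<in> lpa_ideal E \<Longrightarrow> y \<in> lpa_ideal E \<Longrightarrow> x + y \<in> lpa_ideal E"
    and "x \<in> lpa_ideal E \<Longrightarrow> scale c x \<in> lpa_ideal E"
    and "x \<in> lpa_ideal E \<Longrightarrow> set u \<subseteq> lpa_gens E \<Longrightarrow> word u * x \<in> lpa_ideal E"
    and "x \<in> lpa_ideal E \<Longrightarrow> set u \<subseteq> lpa_gens E \<Longrightarrow> x * word u \<in> lpa_ideal E"
    and "x \<in> lpa_relators E \<Longrightarrow> x \<in> lpa_ideal E"
proof -
  interpret star_algebra "free_lpa E :: ('k, _) graded_star_algebra"
    by (rule star_algebra_free_lpa)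
  have ideal: "algebra_ideal (free_lpa E) (lpa_ideal E :: (('v, 'e) lpa_gen list \<Rightarrow>\<^sub>0 'k) set)"
    by (intro ideal_generated_ideal lpa_relators_in_carrier wf_digraph_axioms)
  then show "(0 :: ('v, 'e) lpa_gen list \<Rightarrow>\<^sub>0 'k) \<in> lpa_ideal E"
    and "x \<in> lpa_ideal E \<Longrightarrow> y \<in> lpa_ideal E \<Longrightarrow> x + y \<in> lpa_ideal E"
    and "x \<in> lpa_ideal E \<Longrightarrow> scale c x \<in> lpa_ideal E"
    by (auto simp: algebra_ideal_def linear_subspace_iff)
  \<comment> \<open>The empty word lies outside the non-unital algebra, but acts as the identity.\<close>
  show "word u * x \<in> lpa_ideal E" "x * word u \<in> lpa_ideal E"
    if "x \<in> lpa_ideal E" "set u \<subseteq> lpa_gens E"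
    using ideal that by (cases "u = []"; force simp: algebra_ideal_def word_Nil)+
  show "x \<in> lpa_relators E \<Longrightarrow> x \<in> lpa_ideal E"
    using ideal_generated_superset by blast
qed

lemma cong_refl [simp]: "x \<sim> x"
  by (simp add: lpa_cong_def lpa_ideal_mem)

lemma cong_add: "x \<sim> y \<Longrightarrow> x' \<sim> y' \<Longrightarrow> x + x' \<sim> y + y'"
  using lpa_ideal_mem(2)[of "x - y" "x' - y'"] by (simp add: lpa_cong_def algebra_simps)

lemma cong_scale: "x \<sim> y \<Longrightarrow> scale c x \<sim> scale c y"
  using lpa_ideal_mem(3)[of "x - y" c] by (simp add: lpa_cong_def scale_diff)

lemma cong_trans [trans]: "x \<sim> y \<Longrightarrow> y \<sim> z \<Longrightarrow> x \<sim> z"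
  using lpa_ideal_mem(2)[of "x - y" "y - z"] by (simp add: lpa_cong_def)

lemma cong_sym: "x \<sim> y \<Longrightarrow> y \<sim> x"
  using lpa_ideal_mem(3)[of "x - y" "- 1"] by (simp add: lpa_cong_def scale_minus_one)

lemma cong_eq_trans [trans]: "x \<sim> y \<Longrightarrow> y = z \<Longrightarrow> x \<sim> z"
  and eq_cong_trans [trans]: "x = y \<Longrightarrow> y \<sim> z \<Longrightarrow> x \<sim> z"
  by simp_all

lemma cong_sum: "(\<And>i. i \<in> A \<Longrightarrow> f i \<sim> g i) \<Longrightarrow> sum f A \<sim> sum g A"
  by (induction A rule: infinite_finite_induct) (auto intro: cong_add)

lemma cong_left: "x \<sim> y \<Longrightarrow> set u \<subseteq> lpa_gens E \<Longrightarrow> word u * x \<sim> word u * y"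
  using lpa_ideal_mem(4)[of "x - y" u] by (simp add: lpa_cong_def right_diff_distrib)

lemma cong_right: "x \<sim> y \<Longrightarrow> set u \<subseteq> lpa_gens E \<Longrightarrow> x * word u \<sim> y * word u"
  using lpa_ideal_mem(5)[of "x - y" u] by (simp add: lpa_cong_def left_diff_distrib)

lemma rewrite_word:
  assumes "word r - s \<in> lpa_relators E" "set u \<subseteq> lpa_gens E" "set z \<subseteq> lpa_gens E"
  shows "word (u @ r @ z) \<sim> word u * s * word z"
proof -
  have "word r \<sim> s"
    using assms(1) by (simp add: lpa_cong_def lpa_ideal_mem)
  from cong_right[OF cong_left[OF this assms(2)] assms(3)] show ?thesis
    by simp
qed

lemma gens_intros [simp]:
  "v \<in> verts E \<Longrightarrow> Vertex v \<in> lpa_gens E"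
  "e \<in> arcs E \<Longrightarrow> Edge e \<in> lpa_gens E"
  "e \<in> arcs E \<Longrightarrow> Ghost e \<in> lpa_gens E"
  by (auto simp: lpa_gens_def)

lemma word_rewrites:
  assumes "set u \<subseteq> lpa_gens E" "set z \<subseteq> lpa_gens E"
  shows "v \<in> verts E \<Longrightarrow> w \<in> verts E \<Longrightarrow>
      word (u @ Vertex v # Vertex w # z) \<sim> (if v = w then word (u @ Vertex w # z) else 0)"
    and "e \<in> arcs E \<Longrightarrow> word (u @ Vertex (tail E e) # Edge e # z) \<sim> word (u @ Edge e # z)"
    and "e \<in> arcs E \<Longrightarrow> word (u @ Edge e # Vertex (head E e) # z) \<sim> word (u @ Edge e # z)"
    and "e \<in> arcs E \<Longrightarrow> word (u @ Vertex (head E e) # Ghost e # z) \<sim> word (u @ Ghost e # z)"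
    and "e \<in> arcs E \<Longrightarrow> word (u @ Ghost e # Vertex (tail E e) # z) \<sim> word (u @ Ghost e # z)"
    and "e \<in> arcs E \<Longrightarrow> f \<in> arcs E \<Longrightarrow> word (u @ Ghost e # Edge f # z)
      \<sim> (if e = f then word (u @ Vertex (head E e) # z) else 0)"
    and "regular_vertex E v \<Longrightarrow>
      word (u @ Vertex v # z) \<sim> (\<Sum>e\<in>out_arcs E v. word (u @ Edge e # Ghost e # z))"
  subgoal
    using rewrite_word[OF lpa_relatorsI(1)[of v E w] assms] by (cases "v = w") simp_all
  subgoal using rewrite_word[OF lpa_relatorsI(2)[of e E] assms] by simp
  subgoal using rewrite_word[OF lpa_relatorsI(3)[of e E] assms] by simp
  subgoal using rewrite_word[OF lpa_relatorsI(4)[of e E] assms] by simp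
  subgoal using rewrite_word[OF lpa_relatorsI(5)[of e E] assms] by simp
  subgoal using rewrite_word[OF lpa_relatorsI(6)[of e E f] assms] by (cases "e = f") simp_all
  subgoal
    using rewrite_word[OF lpa_relatorsI(7)[of E v] assms]
    by (simp add: sum_distrib_left sum_distrib_right)
  done

subsection \<open>Paths\<close>

text \<open>
  A path is given by its list of edges and its end vertex, which the list determines unless it is
  empty. Fixing the end rather than the start suits the monomials \<open>\<alpha> \<beta>\<^sup>*\<close>, whose two paths share it.
\<close>

fun path_source :: "'e list \<Rightarrow> 'v \<Rightarrow> 'v" where
  "path_source [] w = w"
| "path_source (e # es) w = tail E e"

fun path_to :: "'e list \<Rightarrow> 'v \<Rightarrow> bool" where
  "path_to [] w \<longleftrightarrow> w \<in> verts E"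
| "path_to (e # es) w \<longleftrightarrow> e \<in> arcs E \<and> path_to es w \<and> head E e = path_source es w"

lemma path_to_snoc: "path_to es (tail E e) \<Longrightarrow> e \<in> arcs E \<Longrightarrow> path_to (es @ [e]) (head E e)"
proof (induction es)
  case (Cons f es)
  then show ?case by (cases es) auto
qed simp

lemma path_to_gens:
  assumes "path_to es w"
  shows "w \<in> verts E" "Edge ` set es \<subseteq> lpa_gens E" "Ghost ` set es \<subseteq> lpa_gens E"
  using assms by (induction es) auto

lemma path_source_in_verts: "path_to es w \<Longrightarrow> path_source es w \<in> verts E"
  by (cases es) auto

definition path_word :: "'e list \<Rightarrow> 'v \<Rightarrow> ('v, 'e) lpa_gen list" where
  "path_word es w = map Edge es @ [Vertex w]"

definition ghost_word :: "'e list \<Rightarrow> 'v \<Rightarrow> ('v, 'e) lpa_gen list" where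
  "ghost_word es w = Vertex w # rev (map Ghost es)"

lemma path_word_gens [simp]: "path_to es w \<Longrightarrow> set (path_word es w) \<subseteq> lpa_gens E"
  and ghost_word_gens [simp]: "path_to es w \<Longrightarrow> set (ghost_word es w) \<subseteq> lpa_gens E"
  using path_to_gens[of es w] by (auto simp: path_word_def ghost_word_def)

lemma vertex_path_word:
  assumes "path_to es w" "v \<in> verts E" "set u \<subseteq> lpa_gens E" "set z \<subseteq> lpa_gens E"
  shows "word (u @ Vertex v # path_word es w @ z)
    \<sim> (if v = path_source es w then word (u @ path_word es w @ z) else 0)"
proof (cases es)
  case Nil
  then show ?thesis
    using word_rewrites(1)[OF assms(3,4), of v w] assms(1,2)
    by (cases "v = w") (simp_all add: path_word_def)
next
  case (Cons e es')
  have e: "e \<in> arcs E" and z: "set (path_word es' w @ z) \<subseteq> lpa_gens E"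
    using assms(1,4) Cons by simp_all
  have "word (u @ Vertex v # Edge e # path_word es' w @ z)
      \<sim> word (u @ Vertex v # Vertex (tail E e) # Edge e # path_word es' w @ z)"
    using cong_sym[OF word_rewrites(2)[of "u @ [Vertex v]" "path_word es' w @ z" e]] assms(2,3) e z
    by simp
  also have "\<dots> \<sim> (if v = tail E e then word (u @ Vertex (tail E e) # Edge e # path_word es' w @ z) else 0)"
    using word_rewrites(1)[OF assms(3), of "Edge e # path_word es' w @ z" v "tail E e"] assms(2) e z by simp
  also have "\<dots> \<sim> (if v = tail E e then word (u @ Edge e # path_word es' w @ z) else 0)"
    using word_rewrites(2)[OF assms(3) z e] by (cases "v = tail E e") simp_all
  finally show ?thesis
    using Cons by (cases "v = tail E e") (simp_all add: path_word_def)
qed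

text \<open>
  Two paths are orthogonal unless one of them extends the other one, which a path that has
  stopped at a sink does not allow.
\<close>

lemma ghost_path_word:
  assumes "path_to es w" "path_to es' w'"
    and "length es = length es' \<or> length es < length es' \<and> out_arcs E w = {}
      \<or> length es' < length es \<and> out_arcs E w' = {}"
  shows "(word (ghost_word es w @ path_word es' w') :: _ \<Rightarrow>\<^sub>0 'k::field) \<sim> (if es = es' \<and> w = w' then word [Vertex w] else 0)"
  using assms
proof (induction es arbitrary: es')
  case Nil
  show ?case
  proof (cases es')
    case Nil
    then show ?thesis
      using word_rewrites(1)[of "[]" "[]" w w'] \<open>path_to [] w\<close> \<open>path_to es' w'\<close>
      by (cases "w = w'") (simp_all add: ghost_word_def path_word_def)
  next
    case (Cons f fs)
    then have "w \<noteq> tail E f"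
      using Nil by auto
    then show ?thesis
      using vertex_path_word[OF Nil(2), of w "[]" "[]"] Nil(1) Cons by (simp add: ghost_word_def)
  qed
next
  case (Cons e es)
  have e: "e \<in> arcs E" "path_to es w" and g: "set (ghost_word es w) \<subseteq> lpa_gens E"
    using Cons.prems by simp_all
  have cons: "ghost_word (e # es) w = ghost_word es w @ [Ghost e]"
    by (simp add: ghost_word_def)
  show ?case
  proof (cases es')
    case Nil
    then have w': "w' \<in> verts E" "tail E e \<noteq> w'"
      using Cons.prems by auto
    have "word (ghost_word es w @ Ghost e # Vertex w' # [])
        \<sim> word (ghost_word es w @ Ghost e # Vertex (tail E e) # Vertex w' # [])"
      using cong_sym[OF word_rewrites(5)[OF g, of "[Vertex w']" e]] e w' by simp
    also have "\<dots> \<sim> 0"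
      using word_rewrites(1)[of "ghost_word es w @ [Ghost e]" "[]" "tail E e" w'] g e w' by simp
    finally show ?thesis
      using Nil by (simp add: cons path_word_def)
  next
    case (Cons f fs)
    have f: "f \<in> arcs E" "path_to fs w'" "head E f = path_source fs w'"
        and p: "set (path_word fs w') \<subseteq> lpa_gens E"
      using Cons.prems Cons by simp_all
    have "word (ghost_word (e # es) w @ path_word es' w')
        = (word (ghost_word es w @ Ghost e # Edge f # path_word fs w') :: _ \<Rightarrow>\<^sub>0 'k)"
      by (simp add: cons Cons path_word_def)
    also have "\<dots> \<sim> (if e = f then word (ghost_word es w @ Vertex (head E e) # path_word fs w') else 0)"
      by (rule word_rewrites(6)[OF g p e(1) f(1)])
    also have "\<dots> \<sim> (if e = f then word (ghost_word es w @ path_word fs w') else 0)"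
      using vertex_path_word[OF f(2) path_source_in_verts[OF f(2)] g, of "[]"] f
      by (cases "e = f") simp_all
    also have "\<dots> \<sim> (if e # es = es' \<and> w = w' then word [Vertex w] else 0)"
      using Cons.IH[OF e(2) f(2)] Cons.prems(3) Cons by auto
    finally show ?thesis .
  qed
qed

subsection \<open>Spanning sets of monomials\<close>

fun monomial :: "'e list \<times> 'v \<times> 'e list \<Rightarrow> ('v, 'e) lpa_gen list" where
  "monomial (a, w, b) = map Edge a @ ghost_word b w"

lemma monomial_path_word: "monomial (a, w, b) = path_word a w @ rev (map Ghost b)"
  by (simp add: path_word_def ghost_word_def)

text \<open>
  Membership in the span modulo the defining ideal; keeping the coefficients as a finitely
  supported function on the index set makes linearity immediate.
\<close>

definition spanned :: "('e list \<times> 'v \<times> 'e list) set \<Rightarrow> (('v, 'e) lpa_gen list \<Rightarrow>\<^sub>0 'k::field) \<Rightarrow> bool" where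
  "spanned D x \<longleftrightarrow> (\<exists>c. Poly_Mapping.keys c \<subseteq> D \<and> x \<sim> linear_extension (\<lambda>d. word (monomial d)) c)"

lemma spanned_cong: "x \<sim> y \<Longrightarrow> spanned D y \<Longrightarrow> spanned D x"
  unfolding spanned_def using cong_trans by blast

lemma spanned_zero [simp]: "spanned D 0"
  unfolding spanned_def by (rule exI[of _ 0]) simp

lemma spanned_add:
  assumes "spanned D x" "spanned D y"
  shows "spanned D (x + y)"
proof -
  obtain c d where c: "Poly_Mapping.keys c \<subseteq> D" "x \<sim> linear_extension (\<lambda>d. word (monomial d)) c"
    and d: "Poly_Mapping.keys d \<subseteq> D" "y \<sim> linear_extension (\<lambda>d. word (monomial d)) d"
    using assms by (auto simp: spanned_def)
  have "Poly_Mapping.keys (c + d) \<subseteq> D"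
    using Poly_Mapping.keys_add[of c d] c(1) d(1) by blast
  with cong_add[OF c(2) d(2)] show ?thesis
    by (auto simp: spanned_def simp flip: linear_extension_add)
qed

lemma spanned_scale:
  assumes "spanned D x"
  shows "spanned D (scale a x)"
proof -
  obtain c where c: "Poly_Mapping.keys c \<subseteq> D" "x \<sim> linear_extension (\<lambda>d. word (monomial d)) c"
    using assms by (auto simp: spanned_def)
  have "Poly_Mapping.keys (scale a c) \<subseteq> D"
    using keys_scale[of a c] c(1) by blast
  with cong_scale[OF c(2), of a] show ?thesis
    by (auto simp: spanned_def simp flip: linear_extension_scale)
qed

lemma spanned_sum: "(\<And>i. i \<in> A \<Longrightarrow> spanned D (f i)) \<Longrightarrow> spanned D (sum f A)"
  by (induction A rule: infinite_finite_induct) (auto intro: spanned_add)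

lemma spanned_monomial: "d \<in> D \<Longrightarrow> spanned D (word (monomial d))"
  unfolding spanned_def by (rule exI[of _ "Poly_Mapping.single d 1"]) simp

lemma spanned_mult_left:
  fixes x :: "('v, 'e) lpa_gen list \<Rightarrow>\<^sub>0 'k::field"
  assumes "spanned D x"
    and "\<And>d. d \<in> D \<Longrightarrow> spanned D' (word u * word (monomial d) :: ('v, 'e) lpa_gen list \<Rightarrow>\<^sub>0 'k)"
    and u: "set u \<subseteq> lpa_gens E"
  shows "spanned D' (word u * x)"
proof -
  obtain c where c: "Poly_Mapping.keys c \<subseteq> D" "x \<sim> linear_extension (\<lambda>d. word (monomial d)) c"
    using assms(1) by (auto simp: spanned_def)
  have "spanned D' (word u * linear_extension (\<lambda>d. word (monomial d)) c)"
    using c(1)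
  proof (induction rule: span_induct_on)
    case (single d)
    then show ?case using assms(2) by simp
  qed (simp_all add: linear_simps distrib_left scale_mult_right spanned_add spanned_scale)
  with cong_left[OF c(2) u] show ?thesis
    by (rule spanned_cong)
qed

definition monomials :: "nat \<Rightarrow> ('e list \<times> 'v \<times> 'e list) set" where
  "monomials N = {(a, w, b). path_to a w \<and> path_to b w \<and> length b \<le> N}"

text \<open>
  Left multiplication by a generator takes a monomial to a monomial or to zero: an edge extends \<open>\<alpha>\<close>, and a
  ghost edge removes the first edge of \<open>\<alpha>\<close> or, if \<open>\<alpha>\<close> is empty, extends \<open>\<beta>\<close>. Only the last case increases the
  length of \<open>\<beta>\<close>.
\<close>

lemma spanned_generator_mult:
  assumes g: "g \<in> lpa_gens E" and "d \<in> monomials N"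
  shows "spanned (monomials (Suc N)) (word [g] * word (monomial d))"
proof -
  obtain a w b where d: "d = (a, w, b)" and a: "path_to a w" and b: "path_to b w" "length b \<le> N"
    using assms(2) by (auto simp: monomials_def)
  have d': "d \<in> monomials (Suc N)"
    using a b by (simp add: d monomials_def)
  have rb: "set (rev (map Ghost b)) \<subseteq> lpa_gens E"
    using path_to_gens(3)[OF b(1)] by simp
  have pa: "set (path_word a w @ rev (map Ghost b)) \<subseteq> lpa_gens E"
    using a rb by simp
  consider v where "g = Vertex v" "v \<in> verts E" | e where "g = Edge e" "e \<in> arcs E"
    | e where "g = Ghost e" "e \<in> arcs E"
    using g by (auto simp: lpa_gens_def)
  then show ?thesis
  proof cases
    case (1 v)
    have "word [g] * word (monomial d) \<sim> (if v = path_source a w then word (monomial d) else 0)"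
      using vertex_path_word[OF a 1(2) _ rb, of "[]"] 1
      by (cases "v = path_source a w") (simp_all add: d monomial_path_word del: monomial.simps)
    then show ?thesis
      by (rule spanned_cong) (simp add: spanned_monomial d')
  next
    case (2 e)
    show ?thesis
    proof (cases "head E e = path_source a w")
      case True
      then have "(e # a, w, b) \<in> monomials (Suc N)"
        using a b 2 by (simp add: monomials_def)
      from spanned_monomial[OF this] show ?thesis
        by (simp add: d 2)
    next
      case False
      have "word (Edge e # path_word a w @ rev (map Ghost b))
          \<sim> word (Edge e # Vertex (head E e) # path_word a w @ rev (map Ghost b))"
        using cong_sym[OF word_rewrites(3)[OF _ pa 2(2), of "[]"]] by simp
      also have "\<dots> \<sim> 0"
        using vertex_path_word[OF a _ _ rb, of "head E e" "[Edge e]"] False 2 by simp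
      finally show ?thesis
        by (intro spanned_cong[OF _ spanned_zero])
           (simp add: d 2 monomial_path_word del: monomial.simps)
    qed
  next
    case (3 e)
    show ?thesis
    proof (cases a)
      case Nil
      then have w: "w \<in> verts E"
        using a by simp
      have "word [g] * word (monomial d) = word (Ghost e # Vertex w # rev (map Ghost b))"
        by (simp add: d Nil 3 ghost_word_def)
      also have "\<dots> \<sim> word (Ghost e # Vertex (tail E e) # Vertex w # rev (map Ghost b))"
        using cong_sym[OF word_rewrites(5)[of "[]" "Vertex w # rev (map Ghost b)" e]] rb w 3 by simp
      also have "\<dots> \<sim> (if tail E e = w then word (Ghost e # Vertex (tail E e) # rev (map Ghost b)) else 0)"
        using word_rewrites(1)[OF _ rb, of "[Ghost e]" "tail E e" w] w 3 by (cases "tail E e = w") simp_all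
      also have "\<dots> \<sim> (if tail E e = w then word (Ghost e # rev (map Ghost b)) else 0)"
        using word_rewrites(5)[OF _ rb 3(2), of "[]"]
        by (cases "tail E e = w") simp_all
      also have "\<dots> \<sim> (if tail E e = w then word (Vertex (head E e) # Ghost e # rev (map Ghost b)) else 0)"
        using cong_sym[OF word_rewrites(4)[OF _ rb 3(2), of "[]"]]
        by (cases "tail E e = w") simp_all
      also have "\<dots> = (if tail E e = w then word (monomial ([], head E e, b @ [e])) else 0)"
        by (simp add: ghost_word_def)
      finally have *: "word [g] * word (monomial d)
        \<sim> (if tail E e = w then word (monomial ([], head E e, b @ [e])) else 0)" .
      have "([], head E e, b @ [e]) \<in> monomials (Suc N)" if "tail E e = w"
        using path_to_snoc[of b e] that b 3 by (simp add: monomials_def)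
      then have "spanned (monomials (Suc N))
          (if tail E e = w then word (monomial ([], head E e, b @ [e])) else 0)"
        by (cases "tail E e = w") (simp_all add: spanned_monomial del: monomial.simps)
      with * show ?thesis
        by (rule spanned_cong)
    next
      case (Cons f a')
      have f: "f \<in> arcs E" "path_to a' w" "head E f = path_source a' w"
        using a Cons by simp_all
      have pa': "set (path_word a' w @ rev (map Ghost b)) \<subseteq> lpa_gens E"
        using f rb by simp
      have "word [g] * word (monomial d) = word (Ghost e # Edge f # path_word a' w @ rev (map Ghost b))"
        by (simp add: d Cons 3 monomial_path_word path_word_def ghost_word_def)
      also have "\<dots> \<sim> (if e = f then word (Vertex (head E e) # path_word a' w @ rev (map Ghost b)) else 0)"
        using word_rewrites(6)[OF _ pa' 3(2) f(1), of "[]"] by (cases "e = f") simp_all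
      also have "\<dots> \<sim> (if e = f then word (path_word a' w @ rev (map Ghost b)) else 0)"
        using vertex_path_word[OF f(2) path_source_in_verts[OF f(2)] _ rb, of "[]"] f
        by (cases "e = f") simp_all
      also have "\<dots> = (if e = f then word (monomial (a', w, b)) else 0)"
        by (simp only: monomial_path_word)
      finally have *: "word [g] * word (monomial d) \<sim> (if e = f then word (monomial (a', w, b)) else 0)" .
      have "(a', w, b) \<in> monomials (Suc N)"
        using f b by (simp add: monomials_def)
      then show ?thesis
        by (intro spanned_cong[OF *]) (simp add: spanned_monomial del: monomial.simps)
    qed
  qed
qed

lemma spanned_word:
  assumes "u \<noteq> []" "set u \<subseteq> lpa_gens E"
  shows "spanned (monomials (length u)) (word u :: _ \<Rightarrow>\<^sub>0 'k::field)"
  using assms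
proof (induction u rule: list_nonempty_induct)
  case (single g)
  then consider v where "g = Vertex v" "v \<in> verts E" | e where "g = Edge e" "e \<in> arcs E"
    | e where "g = Ghost e" "e \<in> arcs E"
    by (auto simp: lpa_gens_def)
  then show ?case
  proof cases
    case (1 v)
    then show ?thesis
      using spanned_monomial[of "([], v, [])" "monomials 1"] by (simp add: monomials_def ghost_word_def)
  next
    case (2 e)
    have "word [g] \<sim> word (monomial ([e], head E e, []))"
      using cong_sym[OF word_rewrites(3)[of "[]" "[]" e]] 2 by (simp add: ghost_word_def)
    then show ?thesis
      by (rule spanned_cong) (use 2 in \<open>auto simp: monomials_def simp del: monomial.simps intro: spanned_monomial\<close>)
  next
    case (3 e)
    have "word [g] \<sim> word (monomial ([], head E e, [e]))"
      using cong_sym[OF word_rewrites(4)[of "[]" "[]" e]] 3 by (simp add: ghost_word_def)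
    then show ?thesis
      by (rule spanned_cong) (use 3 in \<open>auto simp: monomials_def simp del: monomial.simps intro: spanned_monomial\<close>)
  qed
next
  case (cons g u)
  then have IH: "spanned (monomials (length u)) (word u :: _ \<Rightarrow>\<^sub>0 'k)" and "g \<in> lpa_gens E"
    by simp_all
  then have "spanned (monomials (Suc (length u))) (word [g] * word u :: _ \<Rightarrow>\<^sub>0 'k)"
    by (intro spanned_mult_left[OF IH] spanned_generator_mult) auto
  then show ?case by simp
qed

text \<open>
  The relation at regular vertices is a linear dependence between monomials of different lengths.
  Those with \<open>\<beta>\<close> of the fixed length \<open>N\<close>, or shorter and ending in a sink, turn out to be independent.
\<close>

definition reduced_monomials :: "nat \<Rightarrow> ('e list \<times> 'v \<times> 'e list) set" where
  "reduced_monomials N = {(a, w, b). path_to a w \<and> path_to b w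
     \<and> (length b = N \<or> length b < N \<and> out_arcs E w = {})}"

text \<open>
  As long as \<open>\<beta>\<close> is too short and its end \<open>w\<close> is not a sink, \<open>w\<close> is regular by row-finiteness, and the
  relation at \<open>w\<close> replaces \<open>\<alpha> \<beta>\<^sup>*\<close> by the sum of the longer \<open>\<alpha> e (\<beta> e)\<^sup>*\<close>.
\<close>

lemma spanned_reduced:
  assumes "d \<in> monomials N"
  shows "spanned (reduced_monomials N) (word (monomial d) :: _ \<Rightarrow>\<^sub>0 'k::field)"
proof -
  let ?word = "\<lambda>u. word u :: ('v, 'e) lpa_gen list \<Rightarrow>\<^sub>0 'k"
  obtain a w b where d: "d = (a, w, b)" "path_to a w" "path_to b w" "length b \<le> N"
    using assms by (auto simp: monomials_def)
  have "spanned (reduced_monomials N) (?word (monomial (a, w, b)))"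
    using d(2-)
  proof (induction "N - length b" arbitrary: a w b)
    case 0
    then show ?case
      by (intro spanned_monomial) (simp add: reduced_monomials_def)
  next
    case (Suc n)
    show ?case
    proof (cases "out_arcs E w = {}")
      case True
      then show ?thesis
        using Suc by (intro spanned_monomial) (auto simp: reduced_monomials_def)
    next
      case False
      have w: "w \<in> verts E"
        using path_to_gens(1)[OF Suc.prems(1)] .
      have regular: "regular_vertex E w"
        using False w row_finite by (simp add: regular_vertex_def row_finite_def)
      have gens: "set (map Edge a) \<subseteq> lpa_gens E" "set (rev (map Ghost b)) \<subseteq> lpa_gens E"
        using path_to_gens Suc.prems by simp_all
      have "?word (monomial (a, w, b))
          \<sim> (\<Sum>e\<in>out_arcs E w. word (map Edge a @ Edge e # Ghost e # rev (map Ghost b)))"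
        using word_rewrites(7)[OF gens regular] by (simp add: ghost_word_def)
      also have "\<dots> \<sim> (\<Sum>e\<in>out_arcs E w. word (monomial (a @ [e], head E e, b @ [e])))"
      proof (rule cong_sum)
        fix e assume e: "e \<in> out_arcs E w"
        show "?word (map Edge a @ Edge e # Ghost e # rev (map Ghost b))
            \<sim> word (monomial (a @ [e], head E e, b @ [e]))"
          using cong_sym[OF word_rewrites(3)[OF gens(1), of "Ghost e # rev (map Ghost b)" e]] gens(2) e
          by (simp add: ghost_word_def)
      qed
      finally show ?thesis
      proof (rule spanned_cong, intro spanned_sum)
        fix e assume e: "e \<in> out_arcs E w"
        show "spanned (reduced_monomials N) (?word (monomial (a @ [e], head E e, b @ [e])))"
        proof (rule Suc.hyps(1))
          show "n = N - length (b @ [e])" "length (b @ [e]) \<le> N"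
            using Suc.hyps(2) by simp_all
          show "path_to (a @ [e]) (head E e)" "path_to (b @ [e]) (head E e)"
            using e Suc.prems by (auto intro: path_to_snoc)
        qed
      qed
    qed
  qed
  then show ?thesis
    by (simp only: d)
qed

lemma spanned_carrier:
  fixes x :: "('v, 'e) lpa_gen list \<Rightarrow>\<^sub>0 'k::field"
  assumes "x \<in> carrier (free_lpa E)"
  shows "\<exists>N. spanned (reduced_monomials N) x"
proof -
  \<comment> \<open>Any upper bound for the lengths of the words in \<open>x\<close> serves.\<close>
  define N where "N = (\<Sum>w\<in>Poly_Mapping.keys x. length w)"
  have "length w \<le> N" if "w \<in> Poly_Mapping.keys x" for w
    unfolding N_def using that by (intro member_le_sum) auto
  then have "Poly_Mapping.keys x \<subseteq> {w. w \<noteq> [] \<and> set w \<subseteq> lpa_gens E \<and> length w \<le> N}"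
    using assms by (auto simp: in_lists_conv_set)
  then have "spanned (reduced_monomials N) x"
  proof (induction rule: span_induct_on)
    case (single w)
    then have "spanned (monomials (length w)) (word w :: _ \<Rightarrow>\<^sub>0 'k)"
      by (intro spanned_word) auto
    then have "spanned (reduced_monomials N) (word [] * word w :: _ \<Rightarrow>\<^sub>0 'k)"
    proof (rule spanned_mult_left)
      fix d assume "d \<in> monomials (length w)"
      then have "d \<in> monomials N"
        using single by (auto simp: monomials_def)
      then show "spanned (reduced_monomials N) (word [] * word (monomial d) :: _ \<Rightarrow>\<^sub>0 'k)"
        using spanned_reduced by simp
    qed simp
    then show ?case by simp
  qed (simp_all add: spanned_add spanned_scale)
  then show ?thesis ..
qed

text \<open>
  The ideal \<open>C\<close> plays the role of the kernel of a graded homomorphism that is nonzero on vertices; instead of a grading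
  of the target, it suffices that for each vertex \<open>w\<close> some linear form vanishes on \<open>C\<close> and on the words of
  nonzero degree, but not on \<open>w\<close>. Sandwiching an element of \<open>C\<close> between \<open>\<alpha>\<^sub>0\<^sup>*\<close> and \<open>\<beta>\<^sub>0\<close> and applying the form for the common end
  of \<open>\<alpha>\<^sub>0\<close> and \<open>\<beta>\<^sub>0\<close> extracts the coefficient of the reduced monomial \<open>\<alpha>\<^sub>0 \<beta>\<^sub>0\<^sup>*\<close>: different \<open>\<beta>\<close> give zero by
  orthogonality, as do different \<open>\<alpha>\<close> of the same length, and \<open>\<alpha>\<close> of another length leave a word of
  nonzero degree.
\<close>

theorem graded_uniqueness:
  fixes C :: "(('v, 'e) lpa_gen list \<Rightarrow>\<^sub>0 'k::field) set"
  assumes C: "algebra_ideal (free_lpa E) C" "lpa_relators E \<subseteq> C"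
    and add: "\<And>w x y. form w (x + y) = form w x + form w y"
    and scale: "\<And>w c x. form w (scale c x) = c * form w x"
    and vanish: "\<And>w x. w \<in> verts E \<Longrightarrow> x \<in> C \<Longrightarrow> form w x = (0 :: 'k)"
    and degree: "\<And>w u. w \<in> verts E \<Longrightarrow> sum_list (map lpa_gen_deg u) \<noteq> 0 \<Longrightarrow> form w (word u) = 0"
    and vertex: "\<And>w. w \<in> verts E \<Longrightarrow> form w (word [Vertex w]) \<noteq> 0"
  shows "C \<subseteq> lpa_ideal E"
proof
  interpret star_algebra "free_lpa E :: ('k, _) graded_star_algebra"
    by (rule star_algebra_free_lpa)
  fix x assume x: "x \<in> C"
  have subset: "lpa_ideal E \<subseteq> C"
    using C by (rule ideal_generated_minimal)
  have C_closed: "0 \<in> C" "\<And>x y. x \<in> C \<Longrightarrow> y \<in> C \<Longrightarrow> x + y \<in> C" "\<And>c x. x \<in> C \<Longrightarrow> scale c x \<in> C"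
      "C \<subseteq> carrier (free_lpa E)"
    using C(1) by (auto simp: algebra_ideal_def linear_subspace_iff)
  have C_mult: "word u * y \<in> C" "y * word u \<in> C" if "y \<in> C" "u \<noteq> []" "set u \<subseteq> lpa_gens E" for u y
  proof -
    have "word u \<in> carrier (free_lpa E)"
      using that by (auto simp: in_lists_conv_set)
    then show "word u * y \<in> C" "y * word u \<in> C"
      using C(1) that(1) unfolding algebra_ideal_def by (auto simp del: free_lpa_simps(1))
  qed
  have form_cong: "form w y = form w z" if "w \<in> verts E" "y \<sim> z" for w y z
  proof -
    have "form w ((y - z) + z) = form w (y - z) + form w z"
      by (rule add)
    then show ?thesis
      using that vanish subset by (auto simp: lpa_cong_def)
  qed
  have form_zero: "form w 0 = 0" for w
    using scale[of w 0 0] by simp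
  obtain N c where c: "Poly_Mapping.keys c \<subseteq> reduced_monomials N"
      and xc: "x \<sim> linear_extension (\<lambda>d. word (monomial d)) c"
    using spanned_carrier x C_closed(4) unfolding spanned_def by blast
  define x' where "x' = linear_extension (\<lambda>d. word (monomial d)) c"
  have "x' = x + scale (- 1) (x - x')"
    by (simp add: scale_minus_one)
  also have "\<dots> \<in> C"
    using xc subset by (intro C_closed x) (auto simp: lpa_cong_def x'_def)
  finally have x'C: "x' \<in> C" .
  have "Poly_Mapping.keys c = {}"
  proof (rule ccontr)
    assume "Poly_Mapping.keys c \<noteq> {}"
    then obtain d0 where d0: "d0 \<in> Poly_Mapping.keys c" by blast
    obtain a0 w0 b0 where d0_eq: "d0 = (a0, w0, b0)" by (cases d0)
    have p0: "path_to a0 w0" "path_to b0 w0" "length b0 = N \<or> length b0 < N \<and> out_arcs E w0 = {}"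
      using c d0 by (auto simp: d0_eq reduced_monomials_def)
    have w0: "w0 \<in> verts E"
      using path_to_gens(1)[OF p0(1)] .
    let ?y = "\<lambda>z. word (ghost_word a0 w0) * z * word (path_word b0 w0)"
    have "form w0 (?y x') = 0"
      using p0 by (intro vanish C_mult x'C w0 path_word_gens ghost_word_gens)
        (simp_all add: ghost_word_def path_word_def)
    moreover have "form w0 (?y (word (monomial d))) = (if d = d0 then form w0 (word [Vertex w0]) else 0)"
      if "d \<in> Poly_Mapping.keys c" for d
    proof -
      obtain a w b where d: "d = (a, w, b)" by (cases d)
      have p: "path_to a w" "path_to b w" "length b = N \<or> length b < N \<and> out_arcs E w = {}"
        using c that by (auto simp: d reduced_monomials_def)
      have "?y (word (monomial d))
          = word (ghost_word a0 w0 @ map Edge a) * word (ghost_word b w @ path_word b0 w0)"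
        by (simp add: d)
      also have "\<dots> \<sim> word (ghost_word a0 w0 @ map Edge a)
          * (if b = b0 \<and> w = w0 then word [Vertex w] else 0)"
        using p p0 path_to_gens(2)[OF p(1)] by (intro cong_left ghost_path_word) auto
      also have "\<dots> = (if b = b0 \<and> w = w0 then word (ghost_word a0 w0 @ path_word a w0) else 0)"
        by (simp add: path_word_def)
      finally have eq: "form w0 (?y (word (monomial d)))
          = form w0 (if b = b0 \<and> w = w0 then word (ghost_word a0 w0 @ path_word a w0) else 0)"
        by (rule form_cong[OF w0])
      show ?thesis
      proof (cases "b = b0 \<and> w = w0")
        case False
        then show ?thesis using eq by (auto simp: d d0_eq form_zero)
      next
        case bw: True
        show ?thesis
        proof (cases "length a0 = length a")
          case True
          then show ?thesis
            using eq bw form_cong[OF w0 ghost_path_word[OF p0(1), of a w0]] p(1)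
            by (auto simp: d d0_eq form_zero)
        next
          case False
          have "sum_list (map lpa_gen_deg (ghost_word a0 w0 @ path_word a w0))
              = int (length a) - int (length a0)"
            by (simp add: ghost_word_def path_word_def rev_map[symmetric] o_def sum_list_triv)
          then show ?thesis
            using eq bw False degree[OF w0, of "ghost_word a0 w0 @ path_word a w0"]
            by (auto simp: d d0_eq)
        qed
      qed
    qed
    moreover have "form w0 (?y x') = (\<Sum>d\<in>Poly_Mapping.keys c.
        Poly_Mapping.lookup c d * form w0 (?y (word (monomial d))))"
    proof -
      have sum: "form w0 (sum f A) = (\<Sum>i\<in>A. form w0 (f i))" for f and A :: "('e list \<times> 'v \<times> 'e list) set"
        by (induction A rule: infinite_finite_induct) (simp_all add: add form_zero)
      have "?y x' = (\<Sum>d\<in>Poly_Mapping.keys c. scale (Poly_Mapping.lookup c d) (?y (word (monomial d))))"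
        unfolding x'_def linear_extension_def
        by (simp only: sum_distrib_left sum_distrib_right scale_mult_left scale_mult_right)
      then show ?thesis
        by (simp only: sum scale)
    qed
    ultimately have "(\<Sum>d\<in>Poly_Mapping.keys c. if d = d0
        then Poly_Mapping.lookup c d * form w0 (word [Vertex w0]) else 0) = 0"
      by (simp add: if_distrib[of "(*) _"] cong: sum.cong if_cong)
    then have "Poly_Mapping.lookup c d0 * form w0 (word [Vertex w0]) = 0"
      using d0 by simp
    then show False
      using vertex[OF w0] d0 by (simp add: in_keys_iff)
  qed
  then have "x' = 0"
    by (simp add: x'_def linear_extension_def)
  then show "x \<in> lpa_ideal E"
    using xc by (simp add: lpa_cong_def x'_def)
qed

end


section \<open>The embedding\<close>

context leavitt_family begin

abbreviation embed where "embed x \<equiv> to_square (family_map x)"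

lemma embed_hom: "embed \<in> algebra_hom (free_lpa E) sq.P"
  by (auto simp: algebra_hom_def hom_def to_square_carrier family_map_mult to_square_mult
      family_map_linear to_square_linear sq.pair_algebra_simps(2-4))

lemma embed_star: "embed (star (free_lpa E) x) = star sq.P (embed x)"
  by (simp only: to_square_star family_map_star[symmetric])

lemma embed_component:
  assumes "x \<in> component (free_lpa E) n"
  shows "embed x \<in> component sq.P n"
proof (rule to_square_component)
  have "Poly_Mapping.keys x \<subseteq> {w. sum_list (map lpa_gen_deg w) = n}"
    using assms by auto
  then show "left_homogeneous n (family_map x)"
  proof (induction rule: span_induct_on)
    case (single w)
    then show ?case
      using family_map_word_homogeneous[of w] by simp
  next
    case (scale c p)
    then show ?case
      using keys_scale[of c "family_map p"] by (auto simp: left_homogeneous_def family_map_linear)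
  qed (simp_all add: family_map_linear left_homogeneous_add, simp add: left_homogeneous_def)
qed

definition embed_kernel :: "(('v, 'e) lpa_gen list \<Rightarrow>\<^sub>0 'k) set" where
  "embed_kernel = {x \<in> carrier (free_lpa E). embed x \<in> sq.bilin}"

lemma embed_kernel_ideal: "algebra_ideal (free_lpa E) embed_kernel"
proof -
  interpret F: star_algebra "free_lpa E :: ('k, _) graded_star_algebra"
    by (rule star_algebra_free_lpa)
  have "linear_subspace (free_lpa E) embed_kernel"
    unfolding F.linear_subspace_iff embed_kernel_def
    using F.a_closed F.smult_closed
    by (auto simp: family_map_linear to_square_linear sq.bilin_closed)
  moreover have "a \<otimes>\<^bsub>free_lpa E\<^esub> x \<in> embed_kernel \<and> x \<otimes>\<^bsub>free_lpa E\<^esub> a \<in> embed_kernel"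
    if "a \<in> carrier (free_lpa E)" "x \<in> embed_kernel" for a x
  proof -
    have x: "x \<in> carrier (free_lpa E)" "embed x \<in> sq.bilin"
      using that by (simp_all add: embed_kernel_def)
    have "embed (a * x) \<in> sq.bilin" "embed (x * a) \<in> sq.bilin"
      using sq.bilin_ideal x(2) to_square_carrier[of "family_map a"]
      unfolding family_map_mult to_square_mult algebra_ideal_def by blast+
    then show ?thesis
      using F.mult_closed[OF that(1) x(1)] F.mult_closed[OF x(1) that(1)]
      by (simp add: embed_kernel_def)
  qed
  ultimately show ?thesis
    by (simp add: algebra_ideal_def)
qed

lemma embed_kernel_relators: "lpa_relators E \<subseteq> embed_kernel"
  using lpa_relators_in_carrier[OF wf_digraph_axioms] family_map_relator
  unfolding embed_kernel_def sq.cong_zero_iff unfolding square_ideal_def by blast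

text \<open>
  The form for the vertex \<open>w\<close> conjugates by \<open>y w\<close>, which maps the image of \<open>w\<close> to the unit, and
  then applies the linear form of the tensor square.
\<close>

lemma embed_kernel_eq:
  assumes "row_finite E"
  shows "embed_kernel = lpa_ideal E"
proof
  interpret F: star_algebra "free_lpa E :: ('k, _) graded_star_algebra"
    by (rule star_algebra_free_lpa)
  show "lpa_ideal E \<subseteq> embed_kernel"
    by (rule F.ideal_generated_minimal[OF embed_kernel_ideal embed_kernel_relators])
  interpret row_finite_digraph E
    by unfold_locales (rule assms)
  define form where
    "form w x = square_form (pair [] (adj (y w)) * family_map x * pair [] (y w))" for w x
  show "embed_kernel \<subseteq> lpa_ideal E"
  proof (rule graded_uniqueness[OF embed_kernel_ideal embed_kernel_relators, of form])
    show "form w (x + x') = form w x + form w x'" for w x x'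
      by (simp add: form_def family_map_linear distrib_left distrib_right square_form_def linear_simps)
    show "form w (scale c x) = c * form w x" for w c x
      by (simp add: form_def family_map_linear scale_mult_left scale_mult_right square_form_def
          linear_simps)
    show "form w x = 0" if "x \<in> embed_kernel" for w x
    proof -
      have "family_map x \<in> square_ideal"
        using that by (simp add: embed_kernel_def square_ideal_def)
      then show ?thesis
        unfolding form_def by (intro square_form_square_ideal sq.left_mem sq.right_mem)
    qed
    show "form w (word u) = 0" if "sum_list (map lpa_gen_deg u) \<noteq> 0" for w u
    proof -
      have "left_homogeneous (0 + sum_list (map lpa_gen_deg u) + 0)
          (pair [] (adj (y w)) * family_map (word u) * pair [] (y w))"
        by (intro left_homogeneous_mult family_map_word_homogeneous) simp_all
      then show ?thesis
        unfolding form_def using that by (intro square_form_deg) simp_all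
    qed
    show "form w (word [Vertex w]) \<noteq> 0" if "w \<in> verts E" for w
    proof -
      have yy: "(pair [] (adj (y w)) * pair [] (y w) :: 'k free_square) \<approx> 1"
        using vertex_orth[OF that that] by simp
      have "pair [] (adj (y w)) * family_map (word [Vertex w]) * pair [] (y w)
          = (pair [] (adj (y w)) * pair [] (y w)) * (pair [] (adj (y w)) * pair [] (y w) :: 'k free_square)"
        by (simp add: family_map_word)
      also have "\<dots> \<approx> 1 * 1"
        using yy by (rule sq.cong_mult) (rule yy)
      finally have "form w (word [Vertex w]) = square_form (1 :: 'k free_square)"
        unfolding form_def by (intro square_form_cong) simp
      then show ?thesis
        by (simp add: square_form_one)
    qed
  qed
qed

end

theorem theorem4p3:
  fixes K :: "'k::field itself"
    and E :: "('v, 'e) pre_digraph"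
  assumes "wf_digraph E"
    and "countable (verts E)" and "countable (arcs E)"
    and "row_finite E"
  defines "L \<equiv> leavitt_path_algebra K E"
    and "T \<equiv> tensor_product (leavitt_algebra_1_2 K) (trivially_graded (leavitt_algebra_1_2 K))"
  shows "\<exists>\<psi>. \<psi> \<in> algebra_hom L T
    \<and> inj_on \<psi> (carrier L)
    \<and> (\<forall>a\<in>carrier L. \<psi> (star L a) = star T (\<psi> a))
    \<and> (\<forall>n. \<psi> ` component L n \<subseteq> component T n)"
proof -
  obtain y t where "leavitt_family TYPE('k) E y t"
    using leavitt_family_exists[OF assms(1,2,4)] by blast
  then interpret leavitt_family E "TYPE('k)" y t .
  have L: "L = quotient_algebra (free_lpa E) (lpa_ideal E)"
    unfolding L_def by (rule leavitt_path_algebra_eq)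
  have T: "T = quotient_algebra sq.P sq.bilin"
    unfolding T_def tensor_product_def leavitt_algebra_1_2_eq ..
  show ?thesis
    unfolding L T
  proof (rule quotient_embedding[where h = embed])
    show "embed x \<in> sq.bilin \<longleftrightarrow> x \<in> lpa_ideal E" if "x \<in> carrier (free_lpa E)" for x
      using that embed_kernel_eq[OF assms(4)] unfolding embed_kernel_def by blast
    show "component (free_lpa E) n \<subseteq> carrier (free_lpa E)" for n
      by auto
  qed (rule star_ideal_lpa[OF assms(1)] sq.star_ideal_bilin embed_hom embed_star embed_component;
      assumption)+
qed

end
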